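(* Let $\mathcal{M}_*$ be the Gromov space of isometry classes of pointed proper metric spaces, and let $E_{GH}$ and $E_{QI}$ be, respectively, the Gromov-Hausdorff relation and the quasi-isometric relation on $\mathcal{M}_*$. Then for every Polish group $G$ and every Polish $G$-space $X$, with orbit equivalence relation $E^X_G$ on $X$, one has $E_{GH}\nleq_B E^X_G$ and $E_{QI}\nleq_B E^X_G$; that is, neither $E_{GH}$ nor $E_{QI}$ is Borel reducible to $E^X_G$.
   Context: Metrics are finite-valued. A metric space is proper if every open ball has compact closure (equivalently, closed balls are compact). $\mathcal{M}_*$ is the set of isometry classes $[M,x]$ of pointed proper metric spaces $(M,x)$ (isometries being onto and preserving distinguished points). Admissible metrics: for metric spaces $M,N$, a metric on the disjoint union $M\sqcup N$ is admissible if it restricts to $d_M$ on $M$ and to $d_N$ on $N$. Topology of $\mathcal{M}_*$: for subspaces $M,N$ of a metric space with metric $d$, points $x\in M$, $y\in N$, and $R>0$, put $$H_{d,R}(M,x;N,y)=\max\Bigl\{\sup_{u\in B_M(x,R)}d(u,N),\ \sup_{v\in B_N(y,R)}d(v,M)\Bigr\},$$ where $B_M(x,R)$ is the open ball in $M$ of center $x$ and radius $R$. For $R,r>0$, let $U_{R,r}\subset\mathcal{M}_*\times\mathcal{M}_*$ be the set of pairs $([M,x],[N,y])$ for which there is an admissible metric $d$ on $M\sqcup N$ with $\max\{d(x,y),H_{d,R}(M,x;N,y)\}<r$. The sets $U_{R,r}$ form a base of entourages of a metrizable uniformity on $\mathcal{M}_*$, and $\mathcal{M}_*$ carries the induced topology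 (it is a Polish space). Gromov-Hausdorff relation: $d_{GH}(M,N)=\inf_d H_d(M,N)$, where $d$ runs over admissible metrics on $M\sqcup N$ and $H_d(A,B)=\max\{\sup_{a\in A}\inf_{b\in B}d(a,b),\ \sup_{b\in B}\inf_{a\in A}d(a,b)\}$ is the Hausdorff distance (possibly infinite). $E_{GH}$ consists of the pairs $([M,x],[N,y])\in\mathcal{M}_*^2$ with $d_{GH}(M,N)<\infty$. Quasi-isometric relation: a subset $A\subset M$ is a net if there is $C\ge 0$ such that $d_M(x,A)\le C$ for all $x\in M$. A map $\phi$ between metric spaces is bi-Lipschitz if there is $\lambda\ge1$ with $\lambda^{-1}d(u,v)\le d(\phi(u),\phi(v))\le\lambda\, d(u,v)$ for all $u,v$. A (coarse) quasi-isometry of $M$ to $N$ is a bi-Lipschitz bijection $\phi:A\to B$ for some nets $A\subset M$ and $B\subset N$. $E_{QI}$ consists of the pairs $([M,x],[N,y])\in\mathcal{M}_*^2$ such that there is a quasi-isometry of $M$ to $N$. Polish actions: a Polish $G$-space is a Polish space $X$ with a continuous action of the Polish group $G$; $E^X_G$ is the equivalence relation on $X$ whose classes are the $G$-orbits. Borel reducibility: for equivalence relations $E$ on a topological space $X$ and $F$ on a topological space $Y$, $E\le_B F$ means that there is a Borel map $\theta:X\to Y$ such that $x\,E\,x'\Leftrightarrow\theta(x)\,F\,\theta(x')$ for all $x,x'\in X$. *)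

theory Defs
  imports "HOL-Analysis.Analysis" "HOL-Algebra.Group_Action"
begin

section \<open>Metric notions\<close>

text \<open>
  Distances to sets, and suprema of them, are taken in \<^typ>\<open>ennreal\<close>, so that the distance to the
  empty set and the Hausdorff distance between far apart sets are infinite.
\<close>

definition dist_to :: "'a metric \<Rightarrow> 'a \<Rightarrow> 'a set \<Rightarrow> ennreal" where
  "dist_to d u A = (INF a\<in>A. ennreal (mdist d u a))"

definition hausdorff_dist :: "'a metric \<Rightarrow> 'a set \<Rightarrow> 'a set \<Rightarrow> ennreal" where
  "hausdorff_dist d A B = max (SUP a\<in>A. dist_to d a B) (SUP b\<in>B. dist_to d b A)"

definition local_hausdorff_dist ::
    "'a metric \<Rightarrow> real \<Rightarrow> 'a set \<Rightarrow> 'a \<Rightarrow> 'a set \<Rightarrow> 'a \<Rightarrow> ennreal" where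
  "local_hausdorff_dist d R M x N y =
     max (SUP u \<in> M \<inter> mball_of d x R. dist_to d u N) (SUP v \<in> N \<inter> mball_of d y R. dist_to d v M)"

definition proper_metric :: "'a metric \<Rightarrow> bool" where
  "proper_metric M \<longleftrightarrow>
     (\<forall>x\<in>mspace M. \<forall>r. compactin (mtopology_of M) (mtopology_of M closure_of mball_of M x r))"

definition admissible :: "'a metric \<Rightarrow> 'b metric \<Rightarrow> ('a + 'b) metric \<Rightarrow> bool" where
  "admissible M N d \<longleftrightarrow>
     mspace d = mspace M <+> mspace N \<and>
     (\<forall>u\<in>mspace M. \<forall>v\<in>mspace M. mdist d (Inl u) (Inl v) = mdist M u v) \<and>
     (\<forall>u\<in>mspace N. \<forall>v\<in>mspace N. mdist d (Inr u) (Inr v) = mdist N u v)"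

definition GH_dist :: "'a metric \<Rightarrow> 'b metric \<Rightarrow> ennreal" where
  "GH_dist M N =
     (INF d \<in> {d. admissible M N d}. hausdorff_dist d (Inl ` mspace M) (Inr ` mspace N))"

definition net :: "'a metric \<Rightarrow> 'a set \<Rightarrow> bool" where
  "net M A \<longleftrightarrow> A \<subseteq> mspace M \<and> (\<exists>C\<ge>0. \<forall>x\<in>mspace M. dist_to M x A \<le> ennreal C)"

definition bi_Lipschitz_on :: "'a metric \<Rightarrow> 'b metric \<Rightarrow> 'a set \<Rightarrow> ('a \<Rightarrow> 'b) \<Rightarrow> bool" where
  "bi_Lipschitz_on M N A \<phi> \<longleftrightarrow>
     (\<exists>l\<ge>1. \<forall>u\<in>A. \<forall>v\<in>A. inverse l * mdist M u v \<le> mdist N (\<phi> u) (\<phi> v) \<and>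
                           mdist N (\<phi> u) (\<phi> v) \<le> l * mdist M u v)"

definition quasi_isometric :: "'a metric \<Rightarrow> 'b metric \<Rightarrow> bool" where
  "quasi_isometric M N \<longleftrightarrow>
     (\<exists>A B \<phi>. net M A \<and> net N B \<and> bij_betw \<phi> A B \<and> bi_Lipschitz_on M N A \<phi>)"

definition pointed_isometric :: "'a metric \<Rightarrow> 'a \<Rightarrow> 'b metric \<Rightarrow> 'b \<Rightarrow> bool" where
  "pointed_isometric M x N y \<longleftrightarrow>
     (\<exists>f. f ` mspace M = mspace N \<and> f x = y \<and>
          (\<forall>u\<in>mspace M. \<forall>v\<in>mspace M. mdist N (f u) (f v) = mdist M u v))"

lemma pointed_isometric_refl: "pointed_isometric M x M x"
  unfolding pointed_isometric_def by (rule exI[of _ id]) auto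

lemma pointed_isometric_sym:
  assumes "pointed_isometric M x N y" "x \<in> mspace M"
  shows "pointed_isometric N y M x"
proof -
  obtain f where f: "f ` mspace M = mspace N" "f x = y"
    and iso: "\<And>u v. u \<in> mspace M \<Longrightarrow> v \<in> mspace M \<Longrightarrow> mdist N (f u) (f v) = mdist M u v"
    using assms unfolding pointed_isometric_def by blast
  have "u = v" if "u \<in> mspace M" "v \<in> mspace M" "f u = f v" for u v
  proof -
    have "mdist N (f u) (f v) = 0"
      using f(1) that by (metis Metric_space.zero[OF Metric_space_mspace_mdist] imageI)
    then have "mdist M u v = 0"
      by (simp only: iso[OF that(1,2)])
    then show ?thesis
      using Metric_space.zero[OF Metric_space_mspace_mdist that(1,2)] by blast
  qed
  then have inj: "inj_on f (mspace M)"
    by (auto intro: inj_onI)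
  let ?g = "inv_into (mspace M) f"
  have "?g ` mspace N = mspace M"
    using inj f(1) by (metis inv_into_image_cancel subset_refl)
  moreover have "?g y = x"
    using inj f(2) assms(2) by (metis inv_into_f_f)
  moreover have "mdist M (?g u) (?g v) = mdist N u v" if "u \<in> mspace N" "v \<in> mspace N" for u v
    using that f(1) iso[of "?g u" "?g v"] by (simp add: f_inv_into_f inv_into_into)
  ultimately show ?thesis
    unfolding pointed_isometric_def by blast
qed

lemma pointed_isometric_trans:
  assumes "pointed_isometric M x N y" "pointed_isometric N y P z"
  shows "pointed_isometric M x P z"
proof -
  obtain f g where f: "f ` mspace M = mspace N" "f x = y"
      "\<And>u v. u \<in> mspace M \<Longrightarrow> v \<in> mspace M \<Longrightarrow> mdist N (f u) (f v) = mdist M u v"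
    and g: "g ` mspace N = mspace P" "g y = z"
      "\<And>u v. u \<in> mspace N \<Longrightarrow> v \<in> mspace N \<Longrightarrow> mdist P (g u) (g v) = mdist N u v"
    using assms unfolding pointed_isometric_def by metis
  have "f u \<in> mspace N" if "u \<in> mspace M" for u
    using f(1) that by auto
  moreover have "(g \<circ> f) ` mspace M = mspace P"
    unfolding image_comp[symmetric] f(1) g(1) ..
  ultimately show ?thesis
    unfolding pointed_isometric_def
    by (intro exI[of _ "g \<circ> f"]) (simp add: f g)
qed


section \<open>The Gromov space\<close>

text \<open>
  The pointed proper metric spaces form a proper class. Since a proper metric space is separable, it
  has at most the cardinality of the continuum; so every isometry class is represented by a space
  whose underlying set is a set of real numbers (with an arbitrary proper metric, unrelated to the
  usual one). This is lemma \<open>proper_real_model\<close> below. A point of the Gromov space is the set of all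
  representatives of this kind.
\<close>

definition pointed_proper :: "(real metric \<times> real) set" where
  "pointed_proper = {(M, x). proper_metric M \<and> x \<in> mspace M}"

definition pointed_isometry_rel :: "((real metric \<times> real) \<times> (real metric \<times> real)) set" where
  "pointed_isometry_rel =
     {((M, x), (N, y)). (M, x) \<in> pointed_proper \<and> (N, y) \<in> pointed_proper \<and> pointed_isometric M x N y}"

type_synonym isometry_class = "(real metric \<times> real) set"

definition gromov_space :: "isometry_class set" where
  "gromov_space = pointed_proper // pointed_isometry_rel"

definition gromov_entourage :: "real \<Rightarrow> real \<Rightarrow> (isometry_class \<times> isometry_class) set" where
  "gromov_entourage R r =
     {(p, q) \<in> gromov_space \<times> gromov_space. \<exists>(M, x)\<in>p. \<exists>(N, y)\<in>q. \<exists>d. admissible M N d \<and>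
        max (ennreal (mdist d (Inl x) (Inr y)))
            (local_hausdorff_dist d R (Inl ` mspace M) (Inl x) (Inr ` mspace N) (Inr y)) < ennreal r}"

definition gromov_topology :: "isometry_class topology" where
  "gromov_topology = topology (\<lambda>U. U \<subseteq> gromov_space \<and>
     (\<forall>p\<in>U. \<exists>R>0. \<exists>r>0. gromov_entourage R r `` {p} \<subseteq> U))"

definition E_GH :: "(isometry_class \<times> isometry_class) set" where
  "E_GH = {(p, q) \<in> gromov_space \<times> gromov_space. \<exists>(M, x)\<in>p. \<exists>(N, y)\<in>q. GH_dist M N < \<infinity>}"

definition E_QI :: "(isometry_class \<times> isometry_class) set" where
  "E_QI = {(p, q) \<in> gromov_space \<times> gromov_space. \<exists>(M, x)\<in>p. \<exists>(N, y)\<in>q. quasi_isometric M N}"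

lemma equiv_pointed_isometry_rel: "equiv pointed_proper pointed_isometry_rel"
proof (rule equivI)
  show "pointed_isometry_rel \<subseteq> pointed_proper \<times> pointed_proper"
    by (auto simp: pointed_isometry_rel_def)
  show "refl_on pointed_proper pointed_isometry_rel"
    by (auto simp: refl_on_def pointed_isometry_rel_def pointed_isometric_refl)
  show "sym pointed_isometry_rel"
    by (auto simp: sym_def pointed_isometry_rel_def pointed_proper_def intro: pointed_isometric_sym)
  show "trans pointed_isometry_rel"
    by (auto simp: trans_def pointed_isometry_rel_def intro: pointed_isometric_trans)
qed

lemma local_hausdorff_dist_mono:
  assumes "R \<le> R'"
  shows "local_hausdorff_dist d R M x N y \<le> local_hausdorff_dist d R' M x N y"
  unfolding local_hausdorff_dist_def
  by (intro max.mono SUP_subset_mono) (use assms in auto)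

lemma gromov_entourage_mono:
  assumes "R' \<le> R" "r \<le> r'"
  shows "gromov_entourage R r \<subseteq> gromov_entourage R' r'"
proof -
  have "max a (local_hausdorff_dist d R' M x N y) < ennreal r'"
    if "max a (local_hausdorff_dist d R M x N y) < ennreal r"
    for a and d :: "(real + real) metric" and M x N y
    using that local_hausdorff_dist_mono[OF assms(1), of d M x N y] ennreal_leI[OF assms(2)]
    by (meson max.mono order_refl order.strict_trans1 order.strict_trans2)
  then show ?thesis
    unfolding gromov_entourage_def by fast
qed

lemma istopology_gromov:
  "istopology (\<lambda>U. U \<subseteq> gromov_space \<and> (\<forall>p\<in>U. \<exists>R>0. \<exists>r>0. gromov_entourage R r `` {p} \<subseteq> U))"
  unfolding istopology_def
proof (intro conjI allI impI ballI; (elim conjE)?)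
  fix S T p
  assume S: "\<forall>p\<in>S. \<exists>R>0. \<exists>r>0. gromov_entourage R r `` {p} \<subseteq> S"
    and T: "\<forall>p\<in>T. \<exists>R>0. \<exists>r>0. gromov_entourage R r `` {p} \<subseteq> T"
    and p: "p \<in> S \<inter> T"
  obtain R r where 1: "R > 0" "r > 0" "gromov_entourage R r `` {p} \<subseteq> S"
    using S p by blast
  obtain R' r' where 2: "R' > 0" "r' > 0" "gromov_entourage R' r' `` {p} \<subseteq> T"
    using T p by blast
  let ?E = "gromov_entourage (max R R') (min r r')"
  have "?E \<subseteq> gromov_entourage R r" "?E \<subseteq> gromov_entourage R' r'"
    by (simp_all add: gromov_entourage_mono)
  then have "?E `` {p} \<subseteq> S \<inter> T"
    using 1(3) 2(3) by blast
  then show "\<exists>R>0. \<exists>r>0. gromov_entourage R r `` {p} \<subseteq> S \<inter> T"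
    using 1(1,2) 2(1,2) by (meson less_max_iff_disj min_less_iff_conj)
next
  fix K p
  assume K: "\<forall>S\<in>K. S \<subseteq> gromov_space \<and> (\<forall>p\<in>S. \<exists>R>0. \<exists>r>0. gromov_entourage R r `` {p} \<subseteq> S)"
    and "p \<in> \<Union>K"
  then obtain S where S: "S \<in> K" "p \<in> S" by blast
  then have "\<exists>R>0. \<exists>r>0. gromov_entourage R r `` {p} \<subseteq> S"
    using K by blast
  then show "\<exists>R>0. \<exists>r>0. gromov_entourage R r `` {p} \<subseteq> \<Union>K"
    using S(1) by (meson Union_upper order_trans)
qed auto

lemma openin_gromov_topology:
  "openin gromov_topology U \<longleftrightarrow>
     U \<subseteq> gromov_space \<and> (\<forall>p\<in>U. \<exists>R>0. \<exists>r>0. gromov_entourage R r `` {p} \<subseteq> U)"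
  unfolding gromov_topology_def by (simp add: istopology_gromov)

lemma topspace_gromov_topology: "topspace gromov_topology = gromov_space"
proof (rule antisym)
  show "topspace gromov_topology \<subseteq> gromov_space"
    using openin_topspace openin_gromov_topology by blast
  have "gromov_entourage 1 1 `` {p} \<subseteq> gromov_space" for p
    by (auto simp: gromov_entourage_def)
  then have "openin gromov_topology gromov_space"
    unfolding openin_gromov_topology by (meson order_refl zero_less_one)
  then show "gromov_space \<subseteq> topspace gromov_topology"
    by (rule openin_subset)
qed

lemma proper_real_model:
  fixes M :: "'a metric"
  assumes proper: "proper_metric M" and x: "x \<in> mspace M"
  shows "\<exists>(N, y)\<in>pointed_proper. pointed_isometric M x N y"
proof -
  interpret M: Metric_space "mspace M" "mdist M" by simp
  have tb: "M.mtotally_bounded (M.mball x r)" for r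
    using proper x unfolding proper_metric_def mtopology_of_def mball_of_def
    by (metis M.compact_closure_of_imp_mtotally_bounded M.mball_subset_mspace)
  have "\<exists>K. finite K \<and> K \<subseteq> mspace M \<and>
          M.mball x (real n) \<subseteq> (\<Union>c\<in>K. M.mball c (1 / real (Suc k)))" for n k
  proof -
    have "1 / real (Suc k) > 0" by simp
    then show ?thesis
      using tb[of "real n"] M.mball_subset_mspace[of x "real n"]
      unfolding M.mtotally_bounded_def by (meson order_trans)
  qed
  then obtain K where K: "\<And>n k. finite (K n k)" "\<And>n k. K n k \<subseteq> mspace M"
      "\<And>n k. M.mball x (real n) \<subseteq> (\<Union>c\<in>K n k. M.mball c (1 / real (Suc k)))"
    by metis
  define C where "C = (\<Union>n k. K n k)"
  have "countable C"
    unfolding C_def by (intro countable_UN countable_finite[OF K(1)]) simp_all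
  have dense: "\<exists>c\<in>C. mdist M u c < 1 / real (Suc k)" if "u \<in> mspace M" for u k
  proof -
    obtain n where "mdist M x u < real n"
      using reals_Archimedean2 by blast
    then have "u \<in> M.mball x (real n)"
      using x that by simp
    then obtain c where "c \<in> K n k" "u \<in> M.mball c (1 / real (Suc k))"
      using K(3) by blast
    then show ?thesis
      unfolding C_def by (auto simp: M.commute)
  qed
  have CM: "C \<subseteq> mspace M"
    unfolding C_def using K(2) by blast
  define h where
    "h u = {n. mdist M u (from_nat_into C (fst (prod_decode n))) < 1 / real (Suc (snd (prod_decode n)))}"
    for u
  have "inj_on h (mspace M)"
  proof (rule inj_onI, rule ccontr)
    fix u v assume uv: "u \<in> mspace M" "v \<in> mspace M" "h u = h v" "u \<noteq> v"
    then have "mdist M u v / 2 > 0" by simp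
    then obtain k where k: "1 / real (Suc k) < mdist M u v / 2"
      using nat_approx_posE by blast
    obtain c where c: "c \<in> C" "mdist M u c < 1 / real (Suc k)"
      using dense uv(1) by blast
    obtain i where i: "from_nat_into C i = c"
      using from_nat_into_surj[OF \<open>countable C\<close> c(1)] ..
    have "prod_encode (i, k) \<in> h w \<longleftrightarrow> mdist M w c < 1 / real (Suc k)" for w
      unfolding h_def mem_Collect_eq prod_encode_inverse fst_conv snd_conv i ..
    then have "mdist M v c < 1 / real (Suc k)"
      using c(2) uv(3) by blast
    moreover have "mdist M u v \<le> mdist M u c + mdist M c v"
      using uv CM c(1) by (intro M.triangle) auto
    ultimately show False
      using c(2) k by (simp add: M.commute)
  qed
  moreover obtain e :: "nat set \<Rightarrow> real" where "inj e"
    using nat_sets_eqpoll_reals unfolding eqpoll_def bij_betw_def by blast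
  ultimately have inj: "inj_on (e \<circ> h) (mspace M)"
    by (meson comp_inj_on inj_on_subset subset_UNIV)
  define f where "f = e \<circ> h"
  define g where "g = inv_into (mspace M) f"
  have gf: "g (f u) = u" if "u \<in> mspace M" for u
    using inv_into_f_f[OF inj that] by (simp only: f_def g_def)
  define \<rho> where "\<rho> s t = mdist M (g s) (g t)" for s t
  interpret N: Metric_space "f ` mspace M" \<rho>
    by unfold_locales (auto simp: \<rho>_def gf M.commute M.triangle)
  define N where "N = metric (f ` mspace M, \<rho>)"
  have N: "mspace N = f ` mspace M" "mdist N = \<rho>"
    using N.mspace_Self N.mdist_Self unfolding N_def N.Self_def by auto
  have iso: "pointed_isometric M x N (f x)"
    unfolding pointed_isometric_def
    by (rule exI[of _ f]) (simp add: N \<rho>_def gf)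
  interpret MN: Metric_space12 "mspace M" "mdist M" "f ` mspace M" \<rho>
    by unfold_locales
  have hom: "homeomorphic_map M.mtopology N.mtopology f"
    by (rule MN.isometry_imp_homeomorphic_map) (simp_all add: \<rho>_def gf)
  have "compactin N.mtopology (N.mtopology closure_of N.mball z r)" if z: "z \<in> f ` mspace M" for z r
  proof -
    obtain w where w: "w \<in> mspace M" "z = f w" using z by blast
    have ball: "N.mball z r = f ` M.mball w r"
      using w by (auto simp: \<rho>_def gf)
    have "N.mtopology closure_of N.mball z r = f ` (M.mtopology closure_of M.mball w r)"
      unfolding ball using hom
      by (rule homeomorphic_map_closure_of) (simp add: M.mball_subset_mspace)
    moreover have "compactin M.mtopology (M.mtopology closure_of M.mball w r)"
      using proper w(1) unfolding proper_metric_def mtopology_of_def mball_of_def by blast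
    ultimately show ?thesis
      using image_compactin[OF _ homeomorphic_imp_continuous_map[OF hom]] by (simp only:)
  qed
  then have "proper_metric N"
    by (simp add: proper_metric_def mtopology_of_def mball_of_def N)
  then have "(N, f x) \<in> pointed_proper"
    using x by (simp add: pointed_proper_def N)
  with iso show ?thesis by blast
qed


section \<open>Polish group actions and Borel reducibility\<close>

definition Polish_space :: "'a topology \<Rightarrow> bool" where
  "Polish_space X \<longleftrightarrow> separable_space X \<and> completely_metrizable_space X"

definition Polish_group :: "('g, 'm) monoid_scheme \<Rightarrow> 'g topology \<Rightarrow> bool" where
  "Polish_group G T \<longleftrightarrow>
     group G \<and> topspace T = carrier G \<and> Polish_space T \<and>
     continuous_map (prod_topology T T) T (\<lambda>(g, h). g \<otimes>\<^bsub>G\<^esub> h) \<and>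
     continuous_map T T (\<lambda>g. inv\<^bsub>G\<^esub> g)"

definition Polish_G_space ::
    "('g, 'm) monoid_scheme \<Rightarrow> 'g topology \<Rightarrow> 'x topology \<Rightarrow> ('g \<Rightarrow> 'x \<Rightarrow> 'x) \<Rightarrow> bool" where
  "Polish_G_space G T X \<phi> \<longleftrightarrow>
     Polish_space X \<and> group_action G (topspace X) \<phi> \<and>
     continuous_map (prod_topology T X) X (\<lambda>(g, x). \<phi> g x)"

definition orbit_rel ::
    "('g, 'm) monoid_scheme \<Rightarrow> 'x topology \<Rightarrow> ('g \<Rightarrow> 'x \<Rightarrow> 'x) \<Rightarrow> ('x \<times> 'x) set" where
  "orbit_rel G X \<phi> = {(x, y). x \<in> topspace X \<and> y \<in> orbit G \<phi> x}"

definition borel_of :: "'a topology \<Rightarrow> 'a measure" where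
  "borel_of X = sigma (topspace X) {U. openin X U}"

definition Borel_reducible ::
    "'a topology \<Rightarrow> ('a \<times> 'a) set \<Rightarrow> 'b topology \<Rightarrow> ('b \<times> 'b) set \<Rightarrow> bool" where
  "Borel_reducible X E Y F \<longleftrightarrow>
     (\<exists>\<theta> \<in> measurable (borel_of X) (borel_of Y).
        \<forall>x\<in>topspace X. \<forall>x'\<in>topspace X. (x, x') \<in> E \<longleftrightarrow> (\<theta> x, \<theta> x') \<in> F)"

end

theory Submission
  imports Defs
begin

text \<open>
  Points of the Cantor space \<open>2\<^sup>\<nat>\<^sup>\<times>\<^sup>\<nat>\<close> are coded continuously by discrete sets of points on the line, the
  \<open>(n, k)\<close>-th point being moved (for Gromov--Hausdorff) or rescaled (for quasi-isometry) by an
  amount of size \<open>n\<close> according to the \<open>(n, k)\<close>-th bit. Changing bits in one column \<open>n\<close> keeps the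
  space in its class, whereas changing one bit in every column leaves the class.

  A Borel map to a Polish \<open>G\<close>-space that sends column changes into orbits is, as in the theorem of
  Kechris and Louveau on \<open>E\<^sub>1\<close>, unable to see this difference. For generic \<open>x\<close>, every column
  and every neighbourhood \<open>V\<close> of the identity, flipping some far bit of the column moves the image of \<open>x\<close> by an
  element of \<open>V\<close>: countably many translates of a small neighbourhood cover \<open>G\<close>, so one of them is
  used by a nonmeager set of values of the column. Choosing such flips successively, with the
  group elements converging, gives a flip in every column whose total effect is again a single
  group element.
\<close>

text \<open>The obstacle is the quantifier over group elements: the set of points that a flip moves
  by some element of V is a projection, in general only analytic, so its Baire property must be
  proved before category can be applied to it. A second difficulty is that a Borel map is continuous
  only on a comeager set, and the limit of the successive flips must be steered into that set: each
  stage fixes enough bits to secure one more of countably many dense open sets, and later flips stay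
  beyond those bits. A third is that a complete metric on G need not be invariant. The neighbourhood
  for the next flip is therefore chosen only once the product of the earlier group elements is
  known. On the geometric side, the position of a point must carry its index robustly. Ratios of
  successive positions tend to infinity, so a map with bounded multiplicative and additive errors
  has to send each far point to the one of the same index; the class then remembers every far
  position up to a bounded shift or ratio.\<close>

instance bool :: second_countable_topology
proof
  show "\<exists>B::bool set set. countable B \<and> open = generate_topology B"
  proof (intro exI conjI ext)
    show "countable (UNIV :: bool set set)" by (intro countable_finite) simp
    show "open U \<longleftrightarrow> generate_topology UNIV U" for U :: "bool set"
      by (auto simp: open_discrete intro: generate_topology.Basis)
  qed
qed

section \<open>Baire category\<close>

text \<open>Meaningful in every topological space. That comeager sets are nonempty is a separate
  fact, proved for the Cantor space in \<open>comeager_imp_meets\<close>.\<close>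

definition comeager :: "'a::topological_space set \<Rightarrow> bool" where
  "comeager K \<longleftrightarrow> (\<exists>\<O>. countable \<O> \<and> (\<forall>U\<in>\<O>. open U \<and> closure U = UNIV) \<and> \<Inter>\<O> \<subseteq> K)"

lemma dense_iff: "closure U = UNIV \<longleftrightarrow> (\<forall>H. open H \<and> H \<noteq> {} \<longrightarrow> H \<inter> U \<noteq> {})"
proof
  assume "closure U = UNIV"
  then show "\<forall>H. open H \<and> H \<noteq> {} \<longrightarrow> H \<inter> U \<noteq> {}"
    using open_Int_closure_eq_empty by blast
next
  assume *: "\<forall>H. open H \<and> H \<noteq> {} \<longrightarrow> H \<inter> U \<noteq> {}"
  have "- closure U \<inter> U = {}" using closure_subset by blast
  then show "closure U = UNIV" using *[rule_format, of "- closure U"] by auto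
qed

lemma comeager_mono: "comeager K \<Longrightarrow> K \<subseteq> L \<Longrightarrow> comeager L"
  unfolding comeager_def by (meson order_trans)

lemma comeager_open_dense: "open U \<Longrightarrow> closure U = UNIV \<Longrightarrow> comeager U"
  unfolding comeager_def by (rule exI[of _ "{U}"]) auto

lemma comeager_INT:
  assumes "countable I" "\<And>i. i \<in> I \<Longrightarrow> comeager (K i)"
  shows "comeager (\<Inter>i\<in>I. K i)"
proof -
  have "\<forall>i\<in>I. \<exists>\<O>. countable \<O> \<and> (\<forall>U\<in>\<O>. open U \<and> closure U = UNIV) \<and> \<Inter>\<O> \<subseteq> K i"
    using assms(2) unfolding comeager_def by blast
  then obtain \<O> where \<O>: "\<And>i. i \<in> I \<Longrightarrow> countable (\<O> i)"
      "\<And>i U. i \<in> I \<Longrightarrow> U \<in> \<O> i \<Longrightarrow> open U \<and> closure U = UNIV" "\<And>i. i \<in> I \<Longrightarrow> \<Inter>(\<O> i) \<subseteq> K i"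
    by metis
  show ?thesis
    unfolding comeager_def
  proof (intro exI[of _ "\<Union>i\<in>I. \<O> i"] conjI)
    show "countable (\<Union>i\<in>I. \<O> i)" using assms(1) \<O>(1) by (rule countable_UN)
    show "\<forall>U\<in>\<Union>i\<in>I. \<O> i. open U \<and> closure U = UNIV" using \<O>(2) by blast
    show "\<Inter>(\<Union>i\<in>I. \<O> i) \<subseteq> (\<Inter>i\<in>I. K i)" using \<O>(3) by blast
  qed
qed

lemma comeager_Int:
  assumes "comeager K" "comeager L" shows "comeager (K \<inter> L)"
proof -
  have "comeager (\<Inter>b\<in>UNIV. if b then K else L)"
    using assms by (intro comeager_INT) auto
  moreover have "(\<Inter>b\<in>UNIV. if b then K else L) = K \<inter> L"
    by (auto simp: UNIV_bool)
  ultimately show ?thesis by simp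
qed

lemma comeager_UNIV: "comeager UNIV"
  by (simp add: comeager_open_dense)

text \<open>A continuous involution is a homeomorphism, so it pulls dense open sets back to dense
  open sets. All flips are of this kind.\<close>

lemma comeager_vimage_involution:
  assumes "comeager K" and cont: "continuous_on UNIV h" and inv: "\<And>x. h (h x) = x"
  shows "comeager (h -` K)"
proof -
  obtain \<O> where \<O>: "countable \<O>" "\<And>U. U \<in> \<O> \<Longrightarrow> open U \<and> closure U = UNIV" "\<Inter>\<O> \<subseteq> K"
    using assms(1) unfolding comeager_def by blast
  have op: "open (h -` U)" if "open U" for U
    using that cont by (metis continuous_on_open_vimage inf_top_right open_UNIV)
  have "closure (h -` U) = UNIV" if "U \<in> \<O>" for U
    unfolding dense_iff
  proof (intro allI impI)
    fix H :: "'a set" assume H: "open H \<and> H \<noteq> {}"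
    then obtain x where "x \<in> H" by blast
    then have "h x \<in> h -` H" by (simp add: inv)
    then have "open (h -` H)" "h -` H \<noteq> {}"
      using op H by blast+
    then have "h -` H \<inter> U \<noteq> {}" using \<O>(2)[OF that] unfolding dense_iff by blast
    then show "H \<inter> h -` U \<noteq> {}" using inv by auto
  qed
  then show ?thesis
    unfolding comeager_def using \<O> op
    by (intro exI[of _ "(\<lambda>U. h -` U) ` \<O>"]) (auto dest: \<O>(2))
qed

text \<open>The boundary of an open set is nowhere dense. This is the device by which closures are
  replaced by the sets themselves on a comeager set.\<close>

lemma open_dense_Un: 
  assumes "open U" shows "comeager (U \<union> - closure U)"
proof (rule comeager_open_dense)
  show "open (U \<union> - closure U)" using assms by auto
  show "closure (U \<union> - closure U) = UNIV"
    using closure_subset[of "- closure U"] by (auto simp: closure_Un)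
qed

section \<open>The Baire property and where a set is nonmeager\<close>

definition baire_property :: "'a::topological_space set \<Rightarrow> bool" where
  "baire_property S \<longleftrightarrow> (\<exists>U K. open U \<and> comeager K \<and> S \<inter> K = U \<inter> K)"

lemma baire_property_open: "open U \<Longrightarrow> baire_property U"
  unfolding baire_property_def using comeager_UNIV by blast

lemma baire_property_Compl:
  assumes "baire_property S" shows "baire_property (- S)"
proof -
  obtain U K where U: "open U" "comeager K" "S \<inter> K = U \<inter> K"
    using assms unfolding baire_property_def by blast
  have "comeager (K \<inter> (U \<union> - closure U))"
    using U open_dense_Un comeager_Int by blast
  moreover have "- S \<inter> (K \<inter> (U \<union> - closure U)) = - closure U \<inter> (K \<inter> (U \<union> - closure U))"
    using U(3) closure_subset[of U] by blast
  ultimately show ?thesis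
    unfolding baire_property_def by (metis closed_closure open_Compl)
qed

lemma baire_property_UN:
  assumes "countable I" "\<And>i. i \<in> I \<Longrightarrow> baire_property (S i)"
  shows "baire_property (\<Union>i\<in>I. S i)"
proof -
  have "\<forall>i\<in>I. \<exists>U K. open U \<and> comeager K \<and> S i \<inter> K = U \<inter> K"
    using assms(2) unfolding baire_property_def by blast
  then obtain U K where U: "\<And>i. i \<in> I \<Longrightarrow> open (U i) \<and> comeager (K i) \<and> S i \<inter> K i = U i \<inter> K i"
    by metis
  have "comeager (\<Inter>i\<in>I. K i)" using assms(1) U by (intro comeager_INT) auto
  moreover have "open (\<Union>i\<in>I. U i)" using U by blast
  moreover have "(\<Union>i\<in>I. S i) \<inter> (\<Inter>i\<in>I. K i) = (\<Union>i\<in>I. U i) \<inter> (\<Inter>i\<in>I. K i)" 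
    using U by fast
  ultimately show ?thesis unfolding baire_property_def by blast
qed

text \<open>\<open>comeager (- (S \<inter> H))\<close> says that S is meager in H. Removing the
  closure of all such open H leaves an open set in every open part of which S is nonmeager.\<close>

definition nonmeager_interior :: "'a::topological_space set \<Rightarrow> 'a set" where
  "nonmeager_interior S = - closure (\<Union>{H. open H \<and> comeager (- (S \<inter> H))})"

lemma open_nonmeager_interior: "open (nonmeager_interior S)"
  unfolding nonmeager_interior_def by (intro open_Compl closed_closure)

text \<open>Banach's category theorem. By Lindelof, countably many of the open sets in which S is
  meager suffice, and passing to the closure costs only a boundary. The instance for
  \<open>bool\<close> above makes this available on the Cantor space.\<close>

lemma nonmeager_interior_residual:
  fixes S :: "'a::second_countable_topology set"
  shows "comeager (- (S - nonmeager_interior S))"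
proof -
  let ?\<U> = "{H. open H \<and> comeager (- (S \<inter> H))}"
  obtain \<D> where D: "\<D> \<subseteq> ?\<U>" "countable \<D>" "\<Union>\<D> = \<Union>?\<U>"
    using Lindelof[of ?\<U>] by auto
  have "comeager (\<Inter>H\<in>\<D>. - (S \<inter> H))"
    using D by (intro comeager_INT) auto
  moreover have "comeager (\<Union>?\<U> \<union> - closure (\<Union>?\<U>))"
    by (rule open_dense_Un) auto
  ultimately have "comeager ((\<Inter>H\<in>\<D>. - (S \<inter> H)) \<inter> (\<Union>?\<U> \<union> - closure (\<Union>?\<U>)))"
    by (rule comeager_Int)
  then show ?thesis
    by (rule comeager_mono) (use D(3) in \<open>auto simp: nonmeager_interior_def\<close>)
qed

lemma nonmeager_interior_nonmeager:
  assumes "open H" "H \<inter> nonmeager_interior S \<noteq> {}"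
  shows "\<not> comeager (- (S \<inter> H))"
proof
  assume "comeager (- (S \<inter> H))"
  then have "H \<subseteq> \<Union>{H. open H \<and> comeager (- (S \<inter> H))}" using assms(1) by blast
  then show False
    using assms(2) closure_subset unfolding nonmeager_interior_def by blast
qed

text \<open>On an open set disjoint from all the interiors on the right, every S i is meager, hence
  so is their countable union.\<close>

lemma nonmeager_interior_UN:
  fixes S :: "'i \<Rightarrow> 'a::second_countable_topology set"
  assumes I: "countable I"
  shows "nonmeager_interior (\<Union>i\<in>I. S i) \<subseteq> closure (\<Union>i\<in>I. nonmeager_interior (S i))"
proof (rule ccontr)
  let ?C = "closure (\<Union>i\<in>I. nonmeager_interior (S i))"
  define H where "H = nonmeager_interior (\<Union>i\<in>I. S i) - ?C"
  assume "\<not> ?thesis"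
  then have "open H" "H \<inter> nonmeager_interior (\<Union>i\<in>I. S i) \<noteq> {}"
    by (auto simp: H_def open_nonmeager_interior open_Diff)
  then have "\<not> comeager (- ((\<Union>i\<in>I. S i) \<inter> H))"
    by (rule nonmeager_interior_nonmeager)
  moreover have "comeager (\<Inter>i\<in>I. - (S i - nonmeager_interior (S i)))"
    using I nonmeager_interior_residual by (intro comeager_INT) auto
  moreover have "(\<Inter>i\<in>I. - (S i - nonmeager_interior (S i))) \<subseteq> - ((\<Union>i\<in>I. S i) \<inter> H)"
    using closure_subset[of "\<Union>i\<in>I. nonmeager_interior (S i)"] by (auto simp: H_def)
  ultimately show False using comeager_mono by blast
qed

text \<open>The closed ball inside W keeps limits in W, and the lower bound j on the index forces
  nested choices to shrink to a point.\<close>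

lemma (in Metric_space) dense_ball_inside:
  assumes "Abstract_Topology.closure_of mtopology Q = M" "openin mtopology W" "g \<in> W"
  obtains q n where "q \<in> Q" "n \<ge> j" "g \<in> mball q (1 / real (Suc n))" "mcball q (1 / real (Suc n)) \<subseteq> W"
proof -
  obtain \<epsilon> where e: "\<epsilon> > 0" "mball g \<epsilon> \<subseteq> W" and gM: "g \<in> M"
    using assms(2,3) unfolding openin_mtopology by blast
  obtain n0 where n0: "1 / real (Suc n0) < \<epsilon> / 2"
    using nat_approx_posE[of "\<epsilon>/2"] e(1) by auto
  define n where "n = max n0 j"
  have "1 / real (Suc n) \<le> 1 / real (Suc n0)" unfolding n_def by (intro divide_left_mono) auto
  then have n: "1 / real (Suc n) < \<epsilon> / 2" using n0 by linarith
  have "g \<in> Abstract_Topology.closure_of mtopology Q" using assms(1) gM by simp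
  then obtain q where q: "q \<in> Q" "q \<in> mball g (1 / real (Suc n))"
    unfolding metric_closure_of by (smt (verit) mem_Collect_eq of_nat_0_less_iff zero_less_Suc zero_less_divide_1_iff)
  have "mcball q (1 / real (Suc n)) \<subseteq> mball g \<epsilon>"
  proof
    fix h assume h: "h \<in> mcball q (1 / real (Suc n))"
    have "d g h \<le> d g q + d q h" using h q gM by (intro triangle) auto
    then show "h \<in> mball g \<epsilon>" using h q n gM by auto
  qed
  then show thesis
    using e(2) q gM by (intro that[of q n]) (auto simp: n_def commute)
qed

text \<open>
  Special case of Nikodym's theorem that analytic sets have the Baire property: the closed set
  \<open>R\<close> is projected along \<open>V\<close>, and the Suslin scheme is indexed by shrinking balls of \<open>T\<close>.
\<close>

lemma baire_property_projection:
  fixes C :: "'a::second_countable_topology set"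
  assumes T: "Polish_space T" and V: "openin T V" and C: "comeager C"
    and closed: "\<And>\<sigma> \<gamma> z g. \<lbrakk>\<And>j. \<sigma> j \<in> C; z \<in> C; \<sigma> \<longlonglongrightarrow> z; limitin T \<gamma> g sequentially; \<And>j. R (\<sigma> j) (\<gamma> j)\<rbrakk> \<Longrightarrow> R z g"
  shows "baire_property {z\<in>C. \<exists>g\<in>V. R z g}"
proof -
  obtain M d where Md: "Metric_space M d" "Metric_space.mcomplete M d" "T = Metric_space.mtopology M d"
    using T unfolding Polish_space_def completely_metrizable_space_def by blast
  interpret Metric_space M d by (rule Md(1))
  obtain Q where Q: "countable Q" "Q \<subseteq> M" "Abstract_Topology.closure_of T Q = M"
    using T Md(3) unfolding Polish_space_def separable_space_def by auto
  define A where "A W = {z\<in>C. \<exists>g\<in>W. R z g}" for W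
  define B where "B = (\<lambda>(q, n). mball q (1 / real (Suc n)))"
  define ch where "ch W j = {(q, n). q \<in> Q \<and> j \<le> n \<and> mcball q (1 / real (Suc n)) \<subseteq> W}" for W and j :: nat
  \<comment> \<open>Every node of the scheme is V or one of countably many balls, so one comeager
    set can serve all nodes at once.\<close>
  define \<W> where "\<W> = insert V (B ` (Q \<times> UNIV))"
  have ch_count: "countable (ch W j)" for W j
    by (rule countable_subset[of _ "Q \<times> UNIV"]) (auto simp: ch_def Q(1))
  have W_count: "countable \<W>" by (simp add: \<W>_def Q(1))
  have W_open: "openin T W" if "W \<in> \<W>" for W
    using that V by (auto simp: \<W>_def B_def Md(3))
  have cover: "A W = (\<Union>c\<in>ch W j. A (B c))" if W: "openin T W" for W j
  proof -
    have "\<exists>c\<in>ch W j. g \<in> B c" if g: "g \<in> W" for g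
    proof -
      obtain q n where "q \<in> Q" "n \<ge> j" "g \<in> mball q (1 / real (Suc n))" "mcball q (1 / real (Suc n)) \<subseteq> W"
        using dense_ball_inside[OF Q(3)[unfolded Md(3)] W[unfolded Md(3)] g] .
      then show ?thesis by (intro bexI[of _ "(q,n)"]) (auto simp: ch_def B_def)
    qed
    moreover have "B c \<subseteq> W" if "c \<in> ch W j" for c
      using that mball_subset_mcball unfolding ch_def B_def by fastforce
    ultimately have W_eq: "W = \<Union>(B ` ch W j)" by blast
    have "A (\<Union>(B ` J)) = (\<Union>c\<in>J. A (B c))" for J by (auto simp: A_def)
    then show ?thesis using W_eq by metis
  qed
  define I where "I W = nonmeager_interior (A W)" for W
  define L where "L W j = (let U = \<Union>c\<in>ch W j. I (B c) in U \<union> - closure U)" for W j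
  define K where "K = (\<Inter>W\<in>\<W>. \<Inter>j. L W j)"
  have "comeager (L W j)" for W j
    unfolding L_def Let_def by (intro open_dense_Un) (auto simp: I_def open_nonmeager_interior)
  then have "comeager K"
    unfolding K_def by (intro comeager_INT W_count) auto
  \<comment> \<open>Off the boundary excluded by L, lying in the closure of the children's interiors
    means lying in one of them. Hence on K a point of I W can always descend to a child.\<close>
  have step: "\<exists>c\<in>ch W j. z \<in> I (B c)" if z: "z \<in> K" "z \<in> I W" and W: "W \<in> \<W>" for z W j
  proof -
    have "I W \<subseteq> closure (\<Union>c\<in>ch W j. I (B c))"
      unfolding I_def cover[OF W_open[OF W], of j] by (rule nonmeager_interior_UN[OF ch_count])
    then show ?thesis using z W unfolding K_def L_def Let_def by blast
  qed
  \<comment> \<open>The descent gives balls shrinking to some g, with z in the interior of each A (F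
    j). This places z only near points of A (F j), not in it; closedness of R turns such
    approximations into a witness for z itself.\<close>
  have inA: "z \<in> A V" if z: "z \<in> K" "z \<in> I V" "z \<in> C" for z
  proof -
    have "\<exists>F. \<forall>j. (F j \<in> \<W> \<and> z \<in> I (F j) \<and> (j = 0 \<longrightarrow> F j = V)) \<and> (\<exists>c\<in>ch (F j) j. F (Suc j) = B c)"
    proof (rule dependent_nat_choice)
      show "\<exists>W. W \<in> \<W> \<and> z \<in> I W \<and> (0 = 0 \<longrightarrow> W = V)"
        using z(2) by (auto simp: \<W>_def)
      show "\<exists>W'. (W' \<in> \<W> \<and> z \<in> I W' \<and> (Suc j = 0 \<longrightarrow> W' = V)) \<and> (\<exists>c\<in>ch W j. W' = B c)"
        if W: "W \<in> \<W> \<and> z \<in> I W \<and> (j = 0 \<longrightarrow> W = V)" for W j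
      proof -
        obtain c where c: "c \<in> ch W j" "z \<in> I (B c)" using step[OF z(1)] W by blast
        then have "B c \<in> \<W>" by (auto simp: ch_def \<W>_def)
        then show ?thesis using c by auto
      qed
    qed
    then obtain F where F: "\<And>j. F j \<in> \<W>" "\<And>j. z \<in> I (F j)" "F 0 = V"
        "\<And>j. \<exists>c\<in>ch (F j) j. F (Suc j) = B c" by metis
    then obtain c where c: "\<And>j. c j \<in> ch (F j) j" "\<And>j. F (Suc j) = B (c j)" by metis
    define q where "q j = fst (c j)" for j
    define r where "r j = 1 / real (Suc (snd (c j)))" for j
    have qr: "q j \<in> M" "r j > 0" "r j \<le> 1 / real (Suc j)" "mcball (q j) (r j) \<subseteq> F j" "F (Suc j) = mball (q j) (r j)" for j
      using c[of j] Q(2) by (auto simp: q_def r_def ch_def B_def frac_le split: prod.splits)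
    have "F (Suc j) \<subseteq> F j" for j
      using qr(4,5)[of j] mball_subset_mcball by blast
    then have dec: "F j' \<subseteq> F j" if "j \<le> j'" for j j'
      using lift_Suc_antimono_le[of F] that by blast
    have qF: "q j' \<in> F j" if "j \<le> j'" for j j'
      using qr[of j'] dec[OF that] by force
    have near: "d (q j) h < 1 / real (Suc j)" if "h \<in> F (Suc j)" for h j
      using that qr(3,5)[of j] by auto
    have "MCauchy q"
      unfolding MCauchy_def
    proof (intro conjI allI impI)
      show "range q \<subseteq> M" using qr(1) by blast
      fix \<epsilon> :: real assume "\<epsilon> > 0"
      then obtain N where N: "1 / real (Suc N) < \<epsilon> / 2"
        using nat_approx_posE[of "\<epsilon>/2"] by auto
      have "d (q n) (q n') < \<epsilon>" if "Suc N \<le> n" "Suc N \<le> n'" for n n'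
      proof -
        have "d (q n) (q n') \<le> d (q N) (q n) + d (q N) (q n')"
          using qr(1) by (metis commute triangle)
        then show ?thesis using near[OF qF[OF that(1)]] near[OF qF[OF that(2)]] N by linarith
      qed
      then show "\<exists>N. \<forall>n n'. N \<le> n \<longrightarrow> N \<le> n' \<longrightarrow> d (q n) (q n') < \<epsilon>" by blast
    qed
    then obtain g where g: "limitin mtopology q g sequentially"
      using Md(2) unfolding mcomplete_def by blast
    \<comment> \<open>The centres q j' eventually stay in the closed ball chosen inside F j, so
      their limit does not leave F j.\<close>
    have gF: "g \<in> F j" for j
    proof -
      have "g \<in> mcball (q j) (r j)"
      proof (rule limitin_closedin[OF g])
        show "closedin mtopology (mcball (q j) (r j))" by simp
        have "q j' \<in> mcball (q j) (r j)" if "Suc j \<le> j'" for j'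
          using qF[OF that] qr(5)[of j] mball_subset_mcball by blast
        then show "\<forall>\<^sub>F j' in sequentially. q j' \<in> mcball (q j) (r j)"
          unfolding eventually_sequentially by blast
      qed simp
      then show ?thesis using qr(4) by blast
    qed
    obtain N :: "nat \<Rightarrow> 'a set" where N: "\<And>i. open (N i)" "\<And>i. z \<in> N i"
        and Nsub: "\<And>S. open S \<Longrightarrow> z \<in> S \<Longrightarrow> eventually (\<lambda>i. N i \<subseteq> S) sequentially"
      by (rule countable_basis_at_decseq[of z]) (rule that)
    have Nlim: "\<sigma> \<longlonglongrightarrow> z" if "\<And>j. \<sigma> j \<in> N j" for \<sigma>
    proof (rule topological_tendstoI)
      fix S assume "open S" "z \<in> S"
      then show "\<forall>\<^sub>F j in sequentially. \<sigma> j \<in> S"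
        using Nsub by (rule_tac eventually_mono) (use that in blast)+
    qed
    \<comment> \<open>A set that is nonmeager in N j meets N j, because the complement of the empty
      set is comeager.\<close>
    have "\<exists>z'\<in>A (F (Suc j)). z' \<in> N j" for j
    proof -
      have "\<not> comeager (- (A (F (Suc j)) \<inter> N j))"
        by (rule nonmeager_interior_nonmeager) (use N[of j] F(2)[of "Suc j"] in \<open>unfold I_def, blast+\<close>)
      then show ?thesis by (metis Compl_empty_eq comeager_UNIV disjoint_iff)
    qed
    then obtain \<sigma> where \<sigma>: "\<And>j. \<sigma> j \<in> A (F (Suc j))" "\<And>j. \<sigma> j \<in> N j" by metis
    have "\<forall>j. \<exists>h. h \<in> F (Suc j) \<and> R (\<sigma> j) h"
      using \<sigma>(1) unfolding A_def by blast
    then obtain \<gamma> where \<gamma>: "\<And>j. \<gamma> j \<in> F (Suc j)" "\<And>j. R (\<sigma> j) (\<gamma> j)" by metis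
    have "limitin mtopology \<gamma> g sequentially"
      unfolding limit_metric_sequentially
    proof (intro conjI allI impI)
      show "g \<in> M" using g limitin_mspace by blast
      fix \<epsilon> :: real assume "\<epsilon> > 0"
      then obtain n0 where N: "1 / real (Suc n0) < \<epsilon> / 2"
        using nat_approx_posE[of "\<epsilon>/2"] by auto
      have "\<gamma> n \<in> M \<and> d (\<gamma> n) g < \<epsilon>" if "n0 \<le> n" for n
      proof -
        \<comment> \<open>Both \<gamma> n and g lie in the ball of radius at most 1/(n0+1) about q
          n0, so the witnesses converge to g however they were chosen.\<close>
        have "\<gamma> n \<in> F (Suc n0)" using \<gamma>(1)[of n] dec[of "Suc n0" "Suc n"] that by auto
        then have 1: "\<gamma> n \<in> M" "d (q n0) (\<gamma> n) < 1 / real (Suc n0)" 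
          using near qr(5)[of n0] by auto
        have "d (\<gamma> n) g \<le> d (q n0) (\<gamma> n) + d (q n0) g"
          using 1 qr(1) \<open>g \<in> M\<close> by (metis commute triangle)
        then show ?thesis using 1 near[OF gF, of n0] N by linarith
      qed
      then show "\<exists>N. \<forall>n\<ge>N. \<gamma> n \<in> M \<and> d (\<gamma> n) g < \<epsilon>" by blast
    qed
    then have "R z g"
      using closed[of \<sigma> z \<gamma> g] \<sigma> \<gamma> Nlim[of \<sigma>] z(3) unfolding A_def Md(3) by blast
    then show ?thesis unfolding A_def using gF[of 0] F(3) z(3) by blast
  qed
  let ?K = "K \<inter> C \<inter> - (A V - I V)"
  have "comeager ?K"
    unfolding I_def by (intro comeager_Int \<open>comeager K\<close> C nonmeager_interior_residual)
  moreover have "A V \<inter> ?K = I V \<inter> ?K" using inA by blast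
  ultimately show ?thesis
    unfolding baire_property_def A_def[symmetric] using open_nonmeager_interior I_def by metis
qed

section \<open>The Cantor space\<close>

lemma open_agree_on_finite:
  fixes z :: "'i \<Rightarrow> bool"
  assumes "open U" "z \<in> U"
  obtains F where "finite F" "\<And>z'. (\<And>i. i \<in> F \<Longrightarrow> z' i = z i) \<Longrightarrow> z' \<in> U"
proof -
  have "openin (product_topology (\<lambda>_. euclidean) UNIV) U"
    using assms(1) by (simp add: open_fun_def)
  then obtain V where V: "finite {i. V i \<noteq> UNIV}" "z \<in> (\<Pi>\<^sub>E i\<in>UNIV. V i)" "(\<Pi>\<^sub>E i\<in>UNIV. V i) \<subseteq> U"
    using assms(2) unfolding openin_product_topology_alt by (auto 0 4)
  have "z' \<in> U" if "\<And>i. V i \<noteq> UNIV \<Longrightarrow> z' i = z i" for z'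
  proof -
    have "z' i \<in> V i" for i using that[of i] V(2) by (cases "V i = UNIV") (auto simp: PiE_iff)
    then show ?thesis using V(3) by (auto simp: PiE_iff)
  qed
  then show thesis using that[of "{i. V i \<noteq> UNIV}"] V(1) by blast
qed

lemma tendsto_bits:
  fixes z :: "'i \<Rightarrow> bool"
  assumes "\<And>i. \<forall>\<^sub>F j in sequentially. \<sigma> j i = z i"
  shows "\<sigma> \<longlonglongrightarrow> z"
proof (rule topological_tendstoI)
  fix U assume "open U" "z \<in> U"
  then obtain F where F: "finite F" "\<And>z'. (\<And>i. i \<in> F \<Longrightarrow> z' i = z i) \<Longrightarrow> z' \<in> U"
    using open_agree_on_finite by blast
  have "\<forall>\<^sub>F j in sequentially. \<forall>i\<in>F. \<sigma> j i = z i"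
    using F(1) assms by (simp add: eventually_ball_finite)
  then show "\<forall>\<^sub>F j in sequentially. \<sigma> j \<in> U"
    by (rule eventually_mono) (use F(2) in blast)
qed

text \<open>The Baire category theorem enters only here, through compactness of the product of
  two-point spaces.\<close>

lemma comeager_imp_meets:
  fixes H :: "('i \<Rightarrow> bool) set"
  assumes "comeager K" "open H" "H \<noteq> {}"
  shows "H \<inter> K \<noteq> {}"
proof -
  obtain \<O> where \<O>: "countable \<O>" "\<And>U. U \<in> \<O> \<Longrightarrow> open U \<and> closure U = UNIV" "\<Inter>\<O> \<subseteq> K"
    using assms(1) unfolding comeager_def by blast
  have euc: "(euclidean :: ('i \<Rightarrow> bool) topology) = product_topology (\<lambda>_. euclidean) UNIV"
    by (simp add: euclidean_product_topology)
  have "compact_space (euclidean :: bool topology)"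
    by (simp add: compact_space_def finite_imp_compact)
  then have "compact_space (euclidean :: ('i \<Rightarrow> bool) topology)"
    unfolding euc by (simp add: compact_space_product_topology)
  moreover have "Hausdorff_space (euclidean :: ('i \<Rightarrow> bool) topology)"
  proof -
    have "Hausdorff_space (euclidean :: bool topology)"
      unfolding Hausdorff_space_def disjnt_def open_openin[symmetric] using hausdorff[where 'a = bool] by blast
    then show ?thesis unfolding euc by (simp add: Hausdorff_space_product_topology)
  qed
  ultimately have "locally_compact_space (euclidean :: ('i \<Rightarrow> bool) topology) \<and> regular_space (euclidean :: ('i \<Rightarrow> bool) topology)"
    by (simp add: compact_imp_locally_compact_space compact_Hausdorff_imp_regular_space)
  then have "closure (\<Inter>\<O>) = UNIV"
    using Baire_category[of "euclidean :: ('i \<Rightarrow> bool) topology" \<O>] \<O> by simp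
  then show ?thesis using assms \<O>(3) unfolding dense_iff by blast
qed

section \<open>Flips of bits and splitting off a column\<close>

definition flip :: "'i set \<Rightarrow> ('i \<Rightarrow> bool) \<Rightarrow> 'i \<Rightarrow> bool" where
  "flip F x i \<longleftrightarrow> x i \<noteq> (i \<in> F)"

lemma flip_flip: "flip F (flip F' x) = flip ((F - F') \<union> (F' - F)) x"
  by (auto simp: flip_def fun_eq_iff)

lemma flip_empty [simp]: "flip {} x = x"
  by (auto simp: flip_def fun_eq_iff)

lemma continuous_flip: "continuous_on UNIV (flip F)"
proof (rule continuous_on_coordinatewise_then_product)
  fix i
  have "continuous_on UNIV ((\<lambda>b. b \<noteq> (i \<in> F)) \<circ> (\<lambda>x :: 'a \<Rightarrow> bool. x i))"
    by (intro continuous_on_compose continuous_on_product_coordinates) (simp add: continuous_on_discrete)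
  then show "continuous_on UNIV (\<lambda>x. flip F x i)" by (simp add: flip_def comp_def)
qed

lemma comeager_flip: "comeager K \<Longrightarrow> comeager (flip F -` K)"
  by (rule comeager_vimage_involution) (auto intro: continuous_flip simp: flip_flip)

text \<open>The largest subset of K invariant under finite flips. With a countable index type there
  are only countably many of these, so it is comeager when K is.\<close>

definition flip_kernel :: "('i \<Rightarrow> bool) set \<Rightarrow> ('i \<Rightarrow> bool) set" where
  "flip_kernel K = (\<Inter>F\<in>Collect finite. flip F -` K)"

lemma comeager_flip_kernel:
  fixes K :: "('i::countable \<Rightarrow> bool) set"
  shows "comeager K \<Longrightarrow> comeager (flip_kernel K)"
  unfolding flip_kernel_def by (intro comeager_INT comeager_flip) (auto intro: countable_Collect_finite)

lemma flip_kernel_subset: "flip_kernel K \<subseteq> K"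
proof
  fix x assume "x \<in> flip_kernel K"
  then have "flip {} x \<in> K" unfolding flip_kernel_def by blast
  then show "x \<in> K" by simp
qed

lemma flip_in_kernel: 
  assumes "x \<in> flip_kernel K" "finite F" shows "flip F x \<in> flip_kernel K"
  using assms by (auto simp: flip_kernel_def flip_flip)

text \<open>Splits the Cantor space as a product of column n and the rest. Both factors are
  represented by full sequences, so the same notions of category apply to each without a separate
  type of columns.\<close>

definition merge :: "nat \<Rightarrow> (nat \<times> nat \<Rightarrow> bool) \<Rightarrow> (nat \<times> nat \<Rightarrow> bool) \<Rightarrow> nat \<times> nat \<Rightarrow> bool" where
  "merge n x a i = (if fst i = n then a i else x i)"

lemma merge_simps [simp]:
  "merge n (merge n x a) b = merge n x b" "merge n x (merge n a b) = merge n x b" "merge n x x = x"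
  by (auto simp: merge_def fun_eq_iff)

lemma flip_merge: "merge n x (flip {(n, k)} a) = flip {(n, k)} (merge n x a)"
  by (auto simp: merge_def flip_def fun_eq_iff)

lemma continuous_merge_left: "continuous_on UNIV (\<lambda>x. merge n x a)"
proof (rule continuous_on_coordinatewise_then_product)
  show "continuous_on UNIV (\<lambda>x. merge n x a i)" for i
    by (cases "fst i = n") (simp_all add: merge_def continuous_on_product_coordinates)
qed

lemma continuous_merge_right: "continuous_on UNIV (\<lambda>a. merge n x a)"
proof (rule continuous_on_coordinatewise_then_product)
  show "continuous_on UNIV (\<lambda>a. merge n x a i)" for i
    by (cases "fst i = n") (simp_all add: merge_def continuous_on_product_coordinates)
qed

text \<open>The easy direction of the Kuratowski--Ulam theorem, for the factor formed by column \<open>n\<close>.\<close>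

lemma comeager_sections:
  assumes "comeager K"
  shows "comeager {x. comeager {a. merge n x a \<in> K}}"
proof -
  have op_l: "open {x. merge n x a \<in> U}" and op_r: "open {a. merge n x a \<in> U}" if "open U" for x a U
    using that continuous_merge_left[of n a] continuous_merge_right[of n x]
    by (simp_all add: continuous_on_open_vimage vimage_def)
  obtain \<O> where \<O>: "countable \<O>" "\<And>U. U \<in> \<O> \<Longrightarrow> open U \<and> closure U = UNIV" "\<Inter>\<O> \<subseteq> K"
    using assms(1) unfolding comeager_def by blast
  obtain \<B> :: "(nat \<times> nat \<Rightarrow> bool) set set" where \<B>: "countable \<B>" "topological_basis \<B>"
    using ex_countable_basis by blast
  \<comment> \<open>The x whose section of U meets B. If this holds for all basic B, the section is
    dense.\<close>
  define D where "D U B = {x. \<exists>a\<in>B. merge n x a \<in> U}" for U B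
  have "comeager (D U B)" if U: "open U" "closure U = UNIV" and B: "open B" "B \<noteq> {}" for U B
  proof (rule comeager_open_dense)
    have "D U B = (\<Union>a\<in>B. {x. merge n x a \<in> U})" by (auto simp: D_def)
    then show "open (D U B)" using op_l U by auto
    show "closure (D U B) = UNIV"
      unfolding dense_iff
    proof (intro allI impI)
      fix H :: "(nat \<times> nat \<Rightarrow> bool) set" assume H: "open H \<and> H \<noteq> {}"
      obtain x0 a0 where x0: "x0 \<in> H" "a0 \<in> B" using H B by blast
      \<comment> \<open>An open box around \<open>merge n x0 a0\<close>: outside column n it is
        governed by H, inside it by B. A point z of U in this box supplies both a member of H and
        the column that witnesses it.\<close>
      have "open ({z. merge n z x0 \<in> H} \<inter> {z. merge n a0 z \<in> B})"
        using op_l op_r H B by blast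
      moreover have "merge n x0 a0 \<in> {z. merge n z x0 \<in> H} \<inter> {z. merge n a0 z \<in> B}"
        using x0 by simp
      ultimately have "({z. merge n z x0 \<in> H} \<inter> {z. merge n a0 z \<in> B}) \<inter> U \<noteq> {}"
        using U(2)[unfolded dense_iff, rule_format] by (metis empty_iff)
      then obtain z where "z \<in> U" "merge n z x0 \<in> H" "merge n a0 z \<in> B" by blast
      then have "merge n z x0 \<in> H \<inter> D U B"
        by (auto simp: D_def intro!: bexI[of _ "merge n a0 z"])
      then show "H \<inter> D U B \<noteq> {}" by blast
    qed
  qed
  then have D: "comeager (\<Inter>U\<in>\<O>. \<Inter>B\<in>\<B> - {{}}. D U B)"
    using \<O> \<B> by (intro comeager_INT) (auto simp: topological_basis_open)
  have "comeager {a. merge n x a \<in> K}" if x: "x \<in> (\<Inter>U\<in>\<O>. \<Inter>B\<in>\<B> - {{}}. D U B)" for x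
  proof -
    have "closure {a. merge n x a \<in> U} = UNIV" if "U \<in> \<O>" for U
      unfolding dense_iff
    proof (intro allI impI)
      fix H :: "(nat \<times> nat \<Rightarrow> bool) set" assume H: "open H \<and> H \<noteq> {}"
      then obtain B where B: "B \<in> \<B>" "B \<noteq> {}" "B \<subseteq> H"
        using \<B>(2) by (metis empty_iff ex_in_conv topological_basisE)
      then have "x \<in> D U B" using x that by blast
      then show "H \<inter> {a. merge n x a \<in> U} \<noteq> {}"
        using B(3) unfolding D_def by blast
    qed
    then have "comeager (\<Inter>U\<in>\<O>. {a. merge n x a \<in> U})"
      using \<O> op_r by (intro comeager_INT comeager_open_dense) auto
    then show ?thesis by (rule comeager_mono) (use \<O>(3) in blast)
  qed
  then have "(\<Inter>U\<in>\<O>. \<Inter>B\<in>\<B> - {{}}. D U B) \<subseteq> {x. comeager {a. merge n x a \<in> K}}"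
    by (intro subsetI CollectI)
  then show ?thesis by (rule comeager_mono[OF D])
qed

section \<open>Column changes and Polish group actions\<close>

lemma Polish_space_countable_base:
  assumes "Polish_space X"
  obtains \<B> where "countable \<B>" "\<And>B. B \<in> \<B> \<Longrightarrow> openin X B"
    "\<And>U x. openin X U \<Longrightarrow> x \<in> U \<Longrightarrow> \<exists>B\<in>\<B>. x \<in> B \<and> B \<subseteq> U"
proof -
  obtain M d where Md: "Metric_space M d" "X = Metric_space.mtopology M d"
    using assms unfolding Polish_space_def completely_metrizable_space_def by blast
  interpret Metric_space M d by (rule Md(1))
  obtain Q where Q: "countable Q" "Q \<subseteq> M" "Abstract_Topology.closure_of X Q = M"
    using assms Md(2) unfolding Polish_space_def separable_space_def by auto
  define B where "B = (\<lambda>(q, n). mball q (1 / real (Suc n)))"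
  have base: "\<exists>B\<in>B ` (Q \<times> UNIV). x \<in> B \<and> B \<subseteq> U" if U: "openin X U" "x \<in> U" for U x
  proof -
    obtain q n where "q \<in> Q" "x \<in> mball q (1 / real (Suc n))" "mcball q (1 / real (Suc n)) \<subseteq> U"
      using dense_ball_inside[OF Q(3)[unfolded Md(2)] U(1)[unfolded Md(2)] U(2), of 0] .
    then show ?thesis
      using mball_subset_mcball by (intro bexI[of _ "B (q,n)"]) (auto simp: B_def)
  qed
  show thesis
    by (rule that[of "B ` (Q \<times> UNIV)"]) (use base Q(1) in \<open>auto simp: B_def Md(2)\<close>)
qed

text \<open>Preimages of the countably many basic sets agree with open sets on a common comeager
  set. Continuity there is stated by sequences, the form in which the limits below use it.\<close>

lemma continuous_on_residual_set:
  fixes f :: "'a::topological_space \<Rightarrow> 'x"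
  assumes X: "Polish_space X" and f: "\<And>z. f z \<in> topspace X"
    and BP: "\<And>U. openin X U \<Longrightarrow> baire_property (f -` U)"
  obtains C where "comeager C"
    "\<And>\<sigma> z. \<lbrakk>\<And>j. \<sigma> j \<in> C; z \<in> C; \<sigma> \<longlonglongrightarrow> z\<rbrakk> \<Longrightarrow> limitin X (\<lambda>j. f (\<sigma> j)) (f z) sequentially"
proof -
  obtain \<B> where \<B>: "countable \<B>" "\<And>B. B \<in> \<B> \<Longrightarrow> openin X B"
    "\<And>U x. openin X U \<Longrightarrow> x \<in> U \<Longrightarrow> \<exists>B\<in>\<B>. x \<in> B \<and> B \<subseteq> U"
    using Polish_space_countable_base[OF X] by blast
  have "\<forall>B\<in>\<B>. \<exists>V K. open V \<and> comeager K \<and> f -` B \<inter> K = V \<inter> K"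
    using BP \<B>(2) unfolding baire_property_def by blast
  then obtain V K where VK: "\<And>B. B \<in> \<B> \<Longrightarrow> open (V B) \<and> comeager (K B) \<and> f -` B \<inter> K B = V B \<inter> K B"
    by metis
  have "limitin X (\<lambda>j. f (\<sigma> j)) (f z) sequentially"
    if \<sigma>: "\<And>j. \<sigma> j \<in> (\<Inter>B\<in>\<B>. K B)" "z \<in> (\<Inter>B\<in>\<B>. K B)" "\<sigma> \<longlonglongrightarrow> z" for \<sigma> z
    unfolding limitin_def
  proof (intro conjI allI impI f; elim conjE)
    fix U assume "openin X U" "f z \<in> U"
    then obtain B where B: "B \<in> \<B>" "f z \<in> B" "B \<subseteq> U" using \<B>(3) by blast
    then have eq: "\<And>w. w \<in> (\<Inter>B\<in>\<B>. K B) \<Longrightarrow> f w \<in> B \<longleftrightarrow> w \<in> V B" using VK by blast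
    then have "z \<in> V B" using B \<sigma>(2) by blast
    then have "\<forall>\<^sub>F j in sequentially. \<sigma> j \<in> V B"
      using \<sigma>(3) VK[OF B(1)] topological_tendstoD by blast
    then show "\<forall>\<^sub>F j in sequentially. f (\<sigma> j) \<in> U"
      by (rule eventually_mono) (use eq \<sigma>(1) B(3) in blast)
  qed
  moreover have "comeager (\<Inter>B\<in>\<B>. K B)" using VK \<B>(1) by (intro comeager_INT) auto
  ultimately show thesis using that by blast
qed

text \<open>The map f will be a Borel reduction composed with the coding of bits by spaces; the
  assumptions keep what the category argument uses of it.\<close>

locale orbit_coding =
  fixes G (structure) and T :: "'g topology" and X :: "'x topology" and \<phi> :: "'g \<Rightarrow> 'x \<Rightarrow> 'x"
    and f :: "(nat \<times> nat \<Rightarrow> bool) \<Rightarrow> 'x"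
  assumes Polish_group: "Polish_group G T"
    and Polish_action: "Polish_G_space G T X \<phi>"
    and f_space: "f z \<in> topspace X"
    and f_BP: "openin X U \<Longrightarrow> baire_property (f -` U)"
    and f_column: "f (merge n x a) \<in> orbit G \<phi> (f x)"
begin

sublocale group G using Polish_group unfolding Polish_group_def by blast

sublocale act: group_action G "topspace X" \<phi> using Polish_action unfolding Polish_G_space_def by blast

lemma T: "Polish_space T" "topspace T = carrier G" and X: "Polish_space X"
  using Polish_group Polish_action unfolding Polish_group_def Polish_G_space_def by auto

lemma mult_continuous:
  "continuous_map Y T u \<Longrightarrow> continuous_map Y T v \<Longrightarrow> continuous_map Y T (\<lambda>y. u y \<otimes> v y)"
proof -
  assume uv: "continuous_map Y T u" "continuous_map Y T v"
  have "continuous_map Y T ((\<lambda>(g, h). g \<otimes> h) \<circ> (\<lambda>y. (u y, v y)))"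
    by (rule continuous_map_compose[of Y "prod_topology T T"])
       (use uv Polish_group in \<open>auto simp: Polish_group_def continuous_map_pairwise comp_def\<close>)
  then show ?thesis by (simp add: comp_def)
qed

lemma inv_continuous: "continuous_map Y T u \<Longrightarrow> continuous_map Y T (\<lambda>y. inv (u y))"
  using continuous_map_compose[of Y T u T "\<lambda>g. inv g"] Polish_group
  by (simp add: Polish_group_def comp_def)

lemma rmult_continuous: "h \<in> carrier G \<Longrightarrow> continuous_map T T (\<lambda>g. g \<otimes> h)"
  by (intro mult_continuous) (auto simp: T)

lemma limitin_act:
  assumes "limitin T \<gamma> g F" "limitin X \<xi> x F"
  shows "limitin X (\<lambda>j. \<phi> (\<gamma> j) (\<xi> j)) (\<phi> g x) F"
proof -
  have "limitin (prod_topology T X) (\<lambda>j. (\<gamma> j, \<xi> j)) (g, x) F"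
    using assms by (simp add: limitin_pairwise comp_def)
  moreover have "continuous_map (prod_topology T X) X (\<lambda>(g, x). \<phi> g x)"
    using Polish_action unfolding Polish_G_space_def by simp
  ultimately have "limitin X ((\<lambda>(g, x). \<phi> g x) \<circ> (\<lambda>j. (\<gamma> j, \<xi> j))) ((\<lambda>(g, x). \<phi> g x) (g, x)) F"
    by (rule continuous_map_limit[rotated])
  then show ?thesis by (simp add: comp_def)
qed

lemma X_unique: "limitin X \<xi> x sequentially \<Longrightarrow> limitin X \<xi> y sequentially \<Longrightarrow> x = y"
  using X limitin_Hausdorff_unique[of X \<xi> x sequentially y] 
  by (auto simp: Polish_space_def completely_metrizable_imp_metrizable_space metrizable_imp_Hausdorff_space)

text \<open>Fixed by choice once and for all, so that the sets defined from it are constants of the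
  locale.\<close>

definition C where "C = (SOME C. comeager C \<and> (\<forall>\<sigma> z. (\<forall>j. \<sigma> j \<in> C) \<and> z \<in> C \<and> \<sigma> \<longlonglongrightarrow> z \<longrightarrow>
   limitin X (\<lambda>j. f (\<sigma> j)) (f z) sequentially))"

lemma C: "comeager C" 
    "\<lbrakk>\<And>j. \<sigma> j \<in> C; z \<in> C; \<sigma> \<longlonglongrightarrow> z\<rbrakk> \<Longrightarrow> limitin X (\<lambda>j. f (\<sigma> j)) (f z) sequentially"
proof -
  obtain C' where C': "comeager C'"
    "\<And>\<sigma> z. \<lbrakk>\<And>j. \<sigma> j \<in> C'; z \<in> C'; \<sigma> \<longlonglongrightarrow> z\<rbrakk> \<Longrightarrow> limitin X (\<lambda>j. f (\<sigma> j)) (f z) sequentially"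
    using continuous_on_residual_set[OF X, of f] f_space f_BP by blast
  have "\<exists>C. comeager C \<and> (\<forall>\<sigma> z. (\<forall>j. \<sigma> j \<in> C) \<and> z \<in> C \<and> \<sigma> \<longlonglongrightarrow> z \<longrightarrow>
      limitin X (\<lambda>j. f (\<sigma> j)) (f z) sequentially)"
    by (metis C')
  from someI_ex[OF this] have *: "comeager C \<and> (\<forall>\<sigma> z. (\<forall>j. \<sigma> j \<in> C) \<and> z \<in> C \<and> \<sigma> \<longlonglongrightarrow> z \<longrightarrow>
      limitin X (\<lambda>j. f (\<sigma> j)) (f z) sequentially)"
    unfolding C_def .
  show "comeager C" using * by blast
  show "limitin X (\<lambda>j. f (\<sigma> j)) (f z) sequentially" if "\<And>j. \<sigma> j \<in> C" "z \<in> C" "\<sigma> \<longlonglongrightarrow> z" 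
    by (rule conjunct2[OF *, rule_format]) (use that in blast)
qed

text \<open>Invariance under finite flips keeps both a point and its flipped image where f is
  continuous.\<close>

definition D where "D = flip_kernel C"

lemma D: "comeager D" "D \<subseteq> C"
  by (simp_all add: D_def comeager_flip_kernel C flip_kernel_subset)

lemma flip_D: "x \<in> D \<Longrightarrow> finite F \<Longrightarrow> flip F x \<in> D"
  by (simp add: D_def flip_in_kernel)

definition flippable :: "nat \<Rightarrow> nat \<Rightarrow> 'g set \<Rightarrow> (nat \<times> nat \<Rightarrow> bool) set" where
  "flippable n k V = {x\<in>D. \<exists>g\<in>V. f (flip {(n, k)} x) = \<phi> g (f x)}"

text \<open>The relation between z and g is closed on D: f is continuous along both sequences, the
  action is continuous, and limits in X are unique.\<close>

lemma baire_property_flippable: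
  assumes "openin T V" shows "baire_property (flippable n k V)"
  unfolding flippable_def
proof (rule baire_property_projection[OF T(1) assms D(1)])
  fix \<sigma> \<gamma> z g
  assume \<sigma>: "\<And>j. \<sigma> j \<in> D" "z \<in> D" "\<sigma> \<longlonglongrightarrow> z" and \<gamma>: "limitin T \<gamma> g sequentially"
    and eq: "\<And>j. f (flip {(n, k)} (\<sigma> j)) = \<phi> (\<gamma> j) (f (\<sigma> j))"
  have "(\<lambda>j. flip {(n, k)} (\<sigma> j)) \<longlonglongrightarrow> flip {(n, k)} z"
    using continuous_on_tendsto_compose[OF continuous_flip \<sigma>(3)] by simp
  then have "limitin X (\<lambda>j. f (flip {(n, k)} (\<sigma> j))) (f (flip {(n, k)} z)) sequentially"
    by (intro C(2)) (use \<sigma> flip_D D(2) in auto)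
  moreover have "limitin X (\<lambda>j. \<phi> (\<gamma> j) (f (\<sigma> j))) (\<phi> g (f z)) sequentially"
    by (intro limitin_act \<gamma> C(2)) (use \<sigma> D(2) in auto)
  ultimately show "f (flip {(n, k)} z) = \<phi> g (f z)"
    unfolding eq by (rule X_unique)
qed

text \<open>The colours are the sets of group elements that carry f x to f of the changed point;
  \<open>comeager_flippable\<close> colours columns by countably many translates.\<close>

lemma baire_property_colour:
  assumes "openin T V" "comeager {a. merge n x a \<in> D}"
  shows "baire_property {a. merge n x a \<in> D \<and> (\<exists>g\<in>V. f (merge n x a) = \<phi> g (f x))}"
proof -
  have "baire_property {a \<in> {a. merge n x a \<in> D}. \<exists>g\<in>V. f (merge n x a) = \<phi> g (f x)}"
  proof (rule baire_property_projection[OF T(1) assms])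
    fix \<sigma> \<gamma> z g
    assume \<sigma>: "\<And>j. \<sigma> j \<in> {a. merge n x a \<in> D}" "z \<in> {a. merge n x a \<in> D}" "\<sigma> \<longlonglongrightarrow> z"
      and \<gamma>: "limitin T \<gamma> g sequentially"
      and eq: "\<And>j. f (merge n x (\<sigma> j)) = \<phi> (\<gamma> j) (f x)"
    have "(\<lambda>j. merge n x (\<sigma> j)) \<longlonglongrightarrow> merge n x z"
      using continuous_on_tendsto_compose[OF continuous_merge_right \<sigma>(3)] by simp
    then have "limitin X (\<lambda>j. f (merge n x (\<sigma> j))) (f (merge n x z)) sequentially"
      by (intro C(2)) (use \<sigma> D(2) in auto)
    moreover have "limitin X (\<lambda>j. \<phi> (\<gamma> j) (f x)) (\<phi> g (f x)) sequentially"
      by (intro limitin_act \<gamma>) (simp add: f_space)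
    ultimately show "f (merge n x z) = \<phi> g (f x)"
      unfolding eq by (rule X_unique)
  qed
  then show ?thesis by simp
qed

lemma quotient_neighbourhood:
  assumes "openin T V" "\<one> \<in> V"
  obtains W where "openin T W" "\<one> \<in> W" "\<And>a b. a \<in> W \<Longrightarrow> b \<in> W \<Longrightarrow> a \<otimes> inv b \<in> V"
proof -
  have "continuous_map (prod_topology T T) T (\<lambda>p. fst p \<otimes> inv (snd p))"
    by (intro mult_continuous inv_continuous continuous_map_fst continuous_map_snd)
  then have "openin (prod_topology T T) {p \<in> topspace (prod_topology T T). fst p \<otimes> inv (snd p) \<in> V}"
    using assms(1) openin_continuous_map_preimage by blast
  moreover have "(\<one>, \<one>) \<in> {p \<in> topspace (prod_topology T T). fst p \<otimes> inv (snd p) \<in> V}"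
    using assms(2) by (simp add: T)
  ultimately obtain W1 W2 where W: "openin T W1" "openin T W2" "\<one> \<in> W1" "\<one> \<in> W2"
      "W1 \<times> W2 \<subseteq> {p \<in> topspace (prod_topology T T). fst p \<otimes> inv (snd p) \<in> V}"
    unfolding openin_prod_topology_alt by meson
  show thesis
    by (rule that[of "W1 \<inter> W2"]) (use W in auto)
qed

text \<open>A pigeonhole argument in the category sense. If the union missed an open set
  generically, Kuratowski-Ulam would give an x there whose columns are generic too. Countably many
  translates colour these columns; a generic column has a colour that persists on a whole
  neighbourhood up to a meager set, so flipping a far bit keeps the colour. Two elements of one
  translate differ by an element of V, which contradicts the choice of x.\<close>

lemma comeager_flippable:
  assumes V: "openin T V" "\<one> \<in> V"
  shows "comeager (\<Union>k\<in>{m..}. flippable n k V)"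
proof -
  let ?A = "\<Union>k\<in>{m..}. flippable n k V"
  have "baire_property ?A"
    using V by (intro baire_property_UN baire_property_flippable) auto
  then obtain U K where UK: "open U" "comeager K" "?A \<inter> K = U \<inter> K"
    unfolding baire_property_def by blast
  have "closure U = UNIV"
  proof (rule ccontr)
    assume "closure U \<noteq> UNIV"
    then have "open (- closure U)" "- closure U \<noteq> {}" by auto
    then obtain z0 where z0: "z0 \<in> - closure U" by blast
    have "comeager (K \<inter> D)" using UK(2) D(1) by (rule comeager_Int)
    then have "comeager {x. comeager {a. merge n x a \<in> K \<inter> D}}" by (rule comeager_sections)
    then obtain x where x: "x \<in> - closure U" "comeager {a. merge n x a \<in> K \<inter> D}"
      using comeager_imp_meets[of _ "- closure U"] \<open>open (- closure U)\<close> \<open>- closure U \<noteq> {}\<close> by blast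
    define H where "H = (\<lambda>a. merge n x a) -` (- closure U)"
    have H: "open H" "x \<in> H"
      unfolding H_def using x(1) continuous_merge_right[of n x] by (auto intro!: open_vimage)
    have xD: "comeager {a. merge n x a \<in> D}" using x(2) by (rule comeager_mono) blast
    obtain W where W: "openin T W" "\<one> \<in> W" "\<And>a b. a \<in> W \<Longrightarrow> b \<in> W \<Longrightarrow> a \<otimes> inv b \<in> V"
      using quotient_neighbourhood[OF V] by blast
    obtain Q where Q: "countable Q" "Q \<subseteq> carrier G" "Abstract_Topology.closure_of T Q = carrier G"
      using T unfolding Polish_space_def separable_space_def by auto
    \<comment> \<open>The right translate of W by h. With h in the dense set Q these cover
      G.\<close>
    define W' where "W' h = {g \<in> carrier G. g \<otimes> inv h \<in> W}" for h
    have W'_open: "openin T (W' h)" if "h \<in> Q" for h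
      using openin_continuous_map_preimage[OF rmult_continuous W(1), of "inv h"] that Q(2)
      by (auto simp: W'_def T)
    define P where "P h = {a. merge n x a \<in> D \<and> (\<exists>g\<in>W' h. f (merge n x a) = \<phi> g (f x))}" for h
    have "\<forall>h\<in>Q. \<exists>U L. open U \<and> comeager L \<and> P h \<inter> L = U \<inter> L"
      using baire_property_colour[OF W'_open xD] unfolding P_def baire_property_def by blast
    then obtain O' L where OL: "\<And>h. h \<in> Q \<Longrightarrow> open (O' h) \<and> comeager (L h) \<and> P h \<inter> L h = O' h \<inter> L h"
      by metis
    \<comment> \<open>Taking the kernel makes the flipped column as generic as the original one, so
      the same open set \<open>O' h\<close> decides the colour of both.\<close>
    define N where "N = flip_kernel ({a. merge n x a \<in> K \<inter> D} \<inter> (\<Inter>h\<in>Q. L h))"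
    have "comeager N"
      unfolding N_def using OL Q(1) x(2) by (intro comeager_flip_kernel comeager_Int comeager_INT) auto
    then obtain a where a: "a \<in> H" "a \<in> N" 
      using comeager_imp_meets[of N H] H by blast
    have N: "merge n x b \<in> K" "merge n x b \<in> D" "\<And>h. h \<in> Q \<Longrightarrow> b \<in> L h" if "b \<in> N" for b
      using that flip_kernel_subset unfolding N_def by blast+
    obtain g where g: "g \<in> carrier G" "f (merge n x a) = \<phi> g (f x)"
      using f_column[of n x a] unfolding orbit_def by auto
    have "\<exists>h\<in>Q. g \<in> W' h"
    proof -
      have "continuous_map T T (\<lambda>h. g \<otimes> inv h)"
        using g(1) by (intro mult_continuous inv_continuous) (auto simp: T)
      then have 1: "openin T {h \<in> topspace T. g \<otimes> inv h \<in> W}"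
        using W(1) openin_continuous_map_preimage by blast
      have 2: "g \<in> {h \<in> topspace T. g \<otimes> inv h \<in> W}" using g(1) W(2) by (simp add: T)
      have "g \<in> Abstract_Topology.closure_of T Q" using Q(3) g(1) by simp
      then obtain h where "h \<in> Q" "h \<in> {h \<in> topspace T. g \<otimes> inv h \<in> W}"
        using 1 2 unfolding in_closure_of by meson
      then show ?thesis using g(1) by (auto simp: W'_def)
    qed
    then obtain h where h: "h \<in> Q" "g \<in> W' h" by blast
    then have "a \<in> P h" using N(2)[OF a(2)] g by (auto simp: P_def)
    then have "a \<in> O' h \<inter> H" using OL[OF h(1)] N(3)[OF a(2) h(1)] a(1) by blast
    moreover have "open (O' h \<inter> H)" using OL[OF h(1)] H by blast
    ultimately obtain F where F: "finite F" "\<And>b. (\<And>i. i \<in> F \<Longrightarrow> b i = a i) \<Longrightarrow> b \<in> O' h \<inter> H"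
      using open_agree_on_finite[of "O' h \<inter> H" a] by blast
    \<comment> \<open>A bit not among the finitely many that keep a in \<open>O' h\<close>, so
      flipping it does not leave this open set.\<close>
    obtain k where k: "k \<ge> m" "(n, k) \<notin> F"
    proof -
      have "finite (snd ` F)" using F(1) by simp
      then obtain k where "k \<ge> m" "k \<notin> snd ` F"
        by (meson infinite_Ici finite_subset atLeast_iff subsetI)
      then show thesis using that[of k] by force
    qed
    let ?b = "flip {(n, k)} a"
    have "?b \<in> O' h" using F(2)[of ?b] k(2) by (auto simp: flip_def)
    moreover have bN: "?b \<in> N" using a(2) unfolding N_def by (intro flip_in_kernel) auto
    ultimately have "?b \<in> P h" using OL[OF h(1)] N(3)[OF bN h(1)] by blast
    then obtain g' where g': "g' \<in> W' h" "f (flip {(n, k)} (merge n x a)) = \<phi> g' (f x)"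
      by (auto simp: P_def flip_merge)
    have carr: "g \<in> carrier G" "g' \<in> carrier G" "h \<in> carrier G" using h g' Q(2) by (auto simp: W'_def)
    \<comment> \<open>The translating element h cancels, which is why right translates are paired
      with quotients a b^(-1).\<close>
    have "(g' \<otimes> inv h) \<otimes> inv (g \<otimes> inv h) \<in> V"
      using g' h by (intro W(3)) (auto simp: W'_def)
    moreover have "(g' \<otimes> inv h) \<otimes> inv (g \<otimes> inv h) = g' \<otimes> inv g"
    proof -
      have "inv h \<otimes> (h \<otimes> inv g) = inv g" using carr by (simp flip: m_assoc)
      then show ?thesis using carr by (simp add: inv_mult_group m_assoc)
    qed
    ultimately have "g' \<otimes> inv g \<in> V" by simp
    moreover have "\<phi> g' (f x) = \<phi> (g' \<otimes> inv g) (f (merge n x a))"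
      using carr g(2) f_space act.composition_rule[of "f x" "g' \<otimes> inv g" g] by (simp add: m_assoc)
    ultimately have "merge n x a \<in> flippable n k V"
      using g' N(2)[OF a(2)] unfolding flippable_def by auto
    then have "merge n x a \<in> U" using k(1) UK(3) N(1)[OF a(2)] by blast
    moreover have "merge n x a \<notin> U" using a(1) closure_subset unfolding H_def by blast
    ultimately show False by blast
  qed
  then have "comeager (U \<inter> K)" using UK comeager_Int comeager_open_dense by blast
  then show ?thesis by (rule comeager_mono) (use UK(3) in blast)
qed

end

section \<open>A convergent sequence of flips\<close>

lemma (in Metric_space) MCauchy_geometric:
  assumes "range \<sigma> \<subseteq> M" and step: "\<And>n. d (\<sigma> n) (\<sigma> (Suc n)) < (1/2)^n"
  shows "MCauchy \<sigma>"
proof -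
  \<comment> \<open>The subtracted tail is exactly what closes the induction; it is dropped
    afterwards.\<close>
  have "d (\<sigma> n) (\<sigma> (n + p)) \<le> 2 * (1/2)^n - 2 * (1/2)^(n + p)" for n p
  proof (induction p)
    case (Suc p)
    have "d (\<sigma> n) (\<sigma> (n + Suc p)) \<le> d (\<sigma> n) (\<sigma> (n + p)) + d (\<sigma> (n + p)) (\<sigma> (Suc (n + p)))"
      using assms(1) by (simp add: image_subset_iff triangle)
    then show ?case using Suc step[of "n + p"] by simp
  qed (use assms(1) in \<open>auto simp: image_subset_iff\<close>)
  moreover have "2 * (1/2::real)^(n + p) \<ge> 0" for n p by simp
  ultimately have bound: "d (\<sigma> n) (\<sigma> (n + p)) \<le> 2 * (1/2)^n" for n p
    by (smt (verit, best))
  show ?thesis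
    unfolding MCauchy_def
  proof (intro conjI allI impI assms(1))
    fix \<epsilon> :: real assume "\<epsilon> > 0"
    then obtain N where N: "(1/2::real)^N < \<epsilon>/4"
      using real_arch_pow_inv[of "\<epsilon>/4" "1/2"] by auto
    have "d (\<sigma> n) (\<sigma> n') < \<epsilon>" if "N \<le> n" "N \<le> n'" for n n'
    proof -
      have "d (\<sigma> n) (\<sigma> n') \<le> d (\<sigma> N) (\<sigma> n) + d (\<sigma> N) (\<sigma> n')"
        using assms(1) by (metis commute rangeI subsetD triangle)
      then show ?thesis
        using bound[of N "n - N"] bound[of N "n' - N"] that N by simp
    qed
    then show "\<exists>N. \<forall>n n'. N \<le> n \<longrightarrow> N \<le> n' \<longrightarrow> d (\<sigma> n) (\<sigma> n') < \<epsilon>" by blast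
  qed
qed

context orbit_coding
begin

theorem infinite_flip_in_orbit:
  "\<exists>x k. f (flip (range (\<lambda>n. (n, k n))) x) \<in> orbit G \<phi> (f x)"
proof -
  obtain M d where Md: "Metric_space M d" "Metric_space.mcomplete M d" "T = Metric_space.mtopology M d"
    using T unfolding Polish_space_def completely_metrizable_space_def by blast
  interpret Metric_space M d by (rule Md(1))
  have MG: "M = carrier G" using T Md(3) by simp
  obtain \<B> where \<B>: "countable \<B>" "\<And>B. B \<in> \<B> \<Longrightarrow> openin T B"
    "\<And>U x. openin T U \<Longrightarrow> x \<in> U \<Longrightarrow> \<exists>B\<in>\<B>. x \<in> B \<and> B \<subseteq> U"
    using Polish_space_countable_base[OF T(1)] by blast
  obtain \<O> where \<O>: "countable \<O>" "\<And>U. U \<in> \<O> \<Longrightarrow> open U \<and> closure U = UNIV" "\<Inter>\<O> \<subseteq> C"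
    using C(1) unfolding comeager_def by blast
  \<comment> \<open>Inserting \<open>UNIV\<close> makes the family nonempty, so that its enumeration
    has the right range.\<close>
  define U where "U = from_nat_into (insert UNIV \<O>)"
  have range_U: "range U = insert UNIV \<O>"
    unfolding U_def using \<O>(1) by (intro range_from_nat_into) auto
  have U: "open (U n)" "comeager (U n)" for n
    using range_U \<O>(2) comeager_open_dense comeager_UNIV by (metis insertE open_UNIV rangeI)+
  have UC: "z \<in> C" if "\<And>n. z \<in> U n" for z
    using that range_U \<O>(3) by (metis InterI insertCI rangeE subsetD)
  \<comment> \<open>Restricting V to a countable base keeps the intersection countable;
    \<open>R_step\<close> recovers arbitrary neighbourhoods of the identity.\<close>
  define N where "N = (\<Inter>n m. \<Inter>V\<in>{V\<in>\<B>. \<one> \<in> V}. \<Union>k\<in>{m..}. flippable n k V)"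
  define R where "R = flip_kernel (D \<inter> (\<Inter>n. U n) \<inter> N)"
  have "comeager N"
    unfolding N_def using \<B> by (intro comeager_INT comeager_flippable) auto
  then have "comeager R"
    unfolding R_def by (intro comeager_flip_kernel comeager_Int comeager_INT D U) auto
  then obtain x where xR: "x \<in> R" using comeager_imp_meets[of R UNIV] by auto
  have "R \<subseteq> D \<inter> (\<Inter>n. U n) \<inter> N"
    unfolding R_def by (rule flip_kernel_subset)
  then have R: "y \<in> D" "y \<in> U n" "y \<in> N" if "y \<in> R" for y n
    using that by blast+
  have R_step: "\<exists>k\<ge>m. y \<in> flippable n k V" if "y \<in> R" "openin T V" "\<one> \<in> V" for y n m V
  proof -
    obtain B where "B \<in> \<B>" "\<one> \<in> B" "B \<subseteq> V" using \<B>(3) \<open>openin T V\<close> \<open>\<one> \<in> V\<close> by blast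
    moreover have "y \<in> N" using \<open>y \<in> R\<close> by (rule R(3))
    ultimately have "y \<in> (\<Union>k\<in>{m..}. flippable n k B)" unfolding N_def by blast
    then have "\<exists>k\<ge>m. y \<in> flippable n k B" by blast
    then show ?thesis using \<open>B \<subseteq> V\<close> unfolding flippable_def by blast
  qed
  \<comment> \<open>The bound m' concerns the position b within a column, for all columns a at once:
    the flips still to come touch every later column, but only at positions at least m'.\<close>
  have R_open: "\<exists>m'\<ge>m. \<forall>z. (\<forall>a b. b < m' \<longrightarrow> z (a, b) = y (a, b)) \<longrightarrow> z \<in> U n" if y: "y \<in> R" for y n and m :: nat
  proof -
    obtain F where F: "finite F" "\<And>z. (\<And>i. i \<in> F \<Longrightarrow> z i = y i) \<Longrightarrow> z \<in> U n"
      using open_agree_on_finite[OF U(1) R(2)[OF y], of n] by blast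
    obtain m0 where m0: "\<And>i. i \<in> F \<Longrightarrow> snd i < m0"
      using F(1) finite_nat_iff_bounded[of "snd ` F"] by auto
    have "z \<in> U n" if "\<forall>a b. b < max m m0 \<longrightarrow> z (a, b) = y (a, b)" for z
      by (rule F(2)) (metis m0 that max.strict_coboundedI2 prod.collapse)
    then show ?thesis by (intro exI[of _ "max m m0"]) simp
  qed
  \<comment> \<open>A state is a finite flip y of x, a group element g carrying f x to f y, and a
    bound m such that any point agreeing with y below position m lies in U n. Stage n then flips one
    bit of column n.\<close>
  define P where "P n s = (case s of (y, g, m) \<Rightarrow> y \<in> R \<and> g \<in> carrier G \<and> f y = \<phi> g (f x) \<and>
      (\<forall>z. (\<forall>a b. b < m \<longrightarrow> z (a, b) = y (a, b)) \<longrightarrow> z \<in> U n) \<and> (n = 0 \<longrightarrow> y = x))" for n s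
  define S where "S n s s' = (case s of (y, g, m) \<Rightarrow> case s' of (y', g', m') \<Rightarrow>
      (\<exists>k\<ge>m. y' = flip {(n, k)} y) \<and> m \<le> m' \<and> d g g' < (1/2)^n)" 
    for n and s s' :: "(nat \<times> nat \<Rightarrow> bool) \<times> 'g \<times> nat"
  have "\<exists>s. \<forall>n. P n (s n) \<and> S n (s n) (s (Suc n))"
  proof (rule dependent_nat_choice)
    obtain m where "\<forall>z. (\<forall>a b. b < m \<longrightarrow> z (a, b) = x (a, b)) \<longrightarrow> z \<in> U 0"
      using R_open[OF xR] by blast
    then have "P 0 (x, \<one>, m)"
      unfolding P_def using xR act.id_eq_one f_space by (simp flip: act.id_eq_one)
    then show "\<exists>s. P 0 s" ..
    fix s n assume "P n s"
    obtain y g m where s: "s = (y, g, m)" by (metis prod_cases3)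
    then have y: "y \<in> R" "g \<in> carrier G" "f y = \<phi> g (f x)"
      using \<open>P n s\<close> by (auto simp: P_def)
    \<comment> \<open>The neighbourhood depends on the current g: it makes the next product h g
      close to g in a metric that need not be invariant.\<close>
    let ?V = "{h \<in> topspace T. h \<otimes> g \<in> mball g ((1/2)^n)}"
    have "openin T ?V"
      by (rule openin_continuous_map_preimage[OF rmult_continuous[OF y(2)]]) (simp add: Md(3))
    moreover have "g \<in> mball g ((1/2)^n)" using y(2) by (simp add: centre_in_mball_iff flip: MG)
    then have "\<one> \<in> ?V" using y(2) by (simp add: T(2))
    ultimately obtain k where k: "k \<ge> m" "y \<in> flippable n k ?V" using R_step[OF y(1)] by blast
    then obtain h where h: "h \<in> ?V" "f (flip {(n, k)} y) = \<phi> h (f y)"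
      unfolding flippable_def by blast
    have hG: "h \<in> carrier G" using h(1) T by blast
    have yR: "flip {(n, k)} y \<in> R" using y(1) unfolding R_def by (intro flip_in_kernel) auto
    obtain m' where m': "m' \<ge> m" "\<forall>z. (\<forall>a b. b < m' \<longrightarrow> z (a, b) = flip {(n, k)} y (a, b)) \<longrightarrow> z \<in> U (Suc n)"
      using R_open[OF yR] by blast
    have "f (flip {(n, k)} y) = \<phi> (h \<otimes> g) (f x)"
      using h(2) y f_space hG act.composition_rule by simp
    then have "P (Suc n) (flip {(n, k)} y, h \<otimes> g, m')"
      unfolding P_def using yR m'(2) hG y(2) by simp
    moreover have "S n s (flip {(n, k)} y, h \<otimes> g, m')"
      unfolding S_def s using k(1) m'(1) h(1) by auto
    ultimately show "\<exists>s'. P (Suc n) s' \<and> S n s s'" by blast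
  qed
  then obtain s where s: "\<And>n. P n (s n)" "\<And>n. S n (s n) (s (Suc n))" by blast
  define y where "y n = fst (s n)" for n
  define g where "g n = fst (snd (s n))" for n
  define m where "m n = snd (snd (s n))" for n
  have s_eq: "s n = (y n, g n, m n)" for n by (simp add: y_def g_def m_def)
  have y: "y n \<in> R" "g n \<in> carrier G" "f (y n) = \<phi> (g n) (f x)" "y 0 = x"
    and m: "\<And>z. (\<And>a b. b < m n \<Longrightarrow> z (a, b) = y n (a, b)) \<Longrightarrow> z \<in> U n" for n
    using s(1)[of n] s(1)[of 0] by (auto simp: s_eq P_def)
  have "\<forall>n. \<exists>k\<ge>m n. y (Suc n) = flip {(n, k)} (y n)" and m_Suc: "m n \<le> m (Suc n)"
    and g_step: "d (g n) (g (Suc n)) < (1/2)^n" for n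
    using s(2) by (auto simp: s_eq S_def)
  then obtain k where k: "\<And>n. k n \<ge> m n" "\<And>n. y (Suc n) = flip {(n, k n)} (y n)" by metis
  have m_mono: "m n \<le> m n'" if "n \<le> n'" for n n'
    using lift_Suc_mono_le[of m, OF m_Suc that] .
  have y_eq: "y n = flip ((\<lambda>a. (a, k a)) ` {..<n}) x" for n
  proof (induction n)
    case 0 show ?case using y(4) by simp
  next
    case (Suc n)
    have "{(n, k n)} - (\<lambda>a. (a, k a)) ` {..<n} \<union> ((\<lambda>a. (a, k a)) ` {..<n} - {(n, k n)}) = (\<lambda>a. (a, k a)) ` {..<Suc n}"
      by (auto simp: lessThan_Suc)
    then show ?case unfolding k(2) Suc flip_flip by simp
  qed
  define z where "z = flip (range (\<lambda>n. (n, k n))) x"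
  \<comment> \<open>Bits flipped after stage n sit at positions k a \<ge> m a \<ge> m n. So the
    limit z inherits membership in every U n and lies in C.\<close>
  have "z (a, b) = y n (a, b)" if "b < m n" for a b n
    using that k(1)[of a] m_mono[of n a] unfolding z_def y_eq flip_def by (cases "a < n") auto
  then have "z \<in> C" using m by (intro UC) blast
  moreover have "y \<longlonglongrightarrow> z"
  proof (rule tendsto_bits)
    fix i :: "nat \<times> nat"
    have "y n i = z i" if "fst i < n" for n
      using that unfolding z_def y_eq flip_def by auto
    then show "\<forall>\<^sub>F n in sequentially. y n i = z i"
      using eventually_gt_at_top[of "fst i"] by (rule eventually_mono[rotated])
  qed
  ultimately have "limitin X (\<lambda>n. f (y n)) (f z) sequentially"
    using y(1) R(1) D(2) by (intro C(2)) auto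
  moreover have "MCauchy g"
    by (rule MCauchy_geometric) (use g_step y(2) in \<open>auto simp: MG\<close>)
  then obtain h where h: "limitin T g h sequentially"
    using Md(2,3) unfolding mcomplete_def by blast
  then have "limitin X (\<lambda>n. \<phi> (g n) (f x)) (\<phi> h (f x)) sequentially"
    by (rule limitin_act) (simp add: f_space)
  ultimately have "f z = \<phi> h (f x)"
    unfolding y(3) by (rule X_unique)
  moreover have "h \<in> carrier G" using h limitin_topspace T by fastforce
  ultimately show ?thesis unfolding z_def orbit_def by blast
qed

end

section \<open>Coarse embeddings\<close>

text \<open>The common consequence of both relations: finite Gromov-Hausdorff distance gives l = 1,
  a quasi-isometry gives some l \<ge> 1.\<close>

definition coarse_embedding :: "real \<Rightarrow> real \<Rightarrow> 'a metric \<Rightarrow> 'b metric \<Rightarrow> ('a \<Rightarrow> 'b) \<Rightarrow> bool" where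
  "coarse_embedding l C M N \<phi> \<longleftrightarrow> \<phi> ` mspace M \<subseteq> mspace N \<and>
     (\<forall>u\<in>mspace M. \<forall>v\<in>mspace M. mdist M u v / l - C \<le> mdist N (\<phi> u) (\<phi> v) \<and>
                                  mdist N (\<phi> u) (\<phi> v) \<le> l * mdist M u v + C)"

lemma dist_to_lessE:
  assumes "dist_to d u A < ennreal K"
  obtains a where "a \<in> A" "mdist d u a < K"
  using assms mdist_nonneg[of d u] unfolding dist_to_def by (auto simp: INF_less_iff ennreal_less_iff)

lemma mdist_quadrangle:
  assumes "u \<in> mspace M" "v \<in> mspace M" "u' \<in> mspace M" "v' \<in> mspace M"
  shows "\<bar>mdist M u v - mdist M u' v'\<bar> \<le> mdist M u u' + mdist M v v'"
  using mdist_triangle[of u M u' v] mdist_triangle[of u' M v' v] mdist_triangle[of u' M u v'] mdist_triangle[of u M v v'] assms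
  by (simp add: mdist_commute abs_le_iff)

lemma GH_dist_finite_imp_coarse_embedding:
  assumes "GH_dist M N < \<infinity>"
  obtains C \<phi> where "coarse_embedding 1 C M N \<phi>"
proof -
  obtain d where d: "admissible M N d" "hausdorff_dist d (Inl ` mspace M) (Inr ` mspace N) < \<infinity>"
    using assms unfolding GH_dist_def by (auto simp: INF_less_iff)
  then obtain h where h: "hausdorff_dist d (Inl ` mspace M) (Inr ` mspace N) = ennreal h" "h \<ge> 0"
    by (cases "hausdorff_dist d (Inl ` mspace M) (Inr ` mspace N)") auto
  define K where "K = h + 1"
  have K: "hausdorff_dist d (Inl ` mspace M) (Inr ` mspace N) < ennreal K"
    using h by (simp add: K_def ennreal_less_iff)
  have "\<exists>v\<in>mspace N. mdist d (Inl u) (Inr v) < K" if "u \<in> mspace M" for u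
  proof -
    have "dist_to d (Inl u) (Inr ` mspace N) \<le> hausdorff_dist d (Inl ` mspace M) (Inr ` mspace N)"
      unfolding hausdorff_dist_def using that by (intro max.coboundedI1 SUP_upper) auto
    then have "dist_to d (Inl u) (Inr ` mspace N) < ennreal K" using K by (rule le_less_trans)
    then show ?thesis by (elim dist_to_lessE) auto
  qed
  then obtain \<phi> where \<phi>: "\<And>u. u \<in> mspace M \<Longrightarrow> \<phi> u \<in> mspace N" "\<And>u. u \<in> mspace M \<Longrightarrow> mdist d (Inl u) (Inr (\<phi> u)) < K"
    by metis
  have "\<bar>mdist M u v - mdist N (\<phi> u) (\<phi> v)\<bar> \<le> 2 * K" if "u \<in> mspace M" "v \<in> mspace M" for u v
  proof -
    have "Inl u \<in> mspace d" "Inl v \<in> mspace d" "Inr (\<phi> u) \<in> mspace d" "Inr (\<phi> v) \<in> mspace d"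
      using d(1) \<phi>(1) that unfolding admissible_def by auto
    from mdist_quadrangle[OF this]
    have "\<bar>mdist M u v - mdist N (\<phi> u) (\<phi> v)\<bar> \<le> mdist d (Inl u) (Inr (\<phi> u)) + mdist d (Inl v) (Inr (\<phi> v))"
      using d(1) \<phi>(1) that unfolding admissible_def by simp
    then show ?thesis using \<phi>(2)[OF that(1)] \<phi>(2)[OF that(2)] by linarith
  qed
  then have "coarse_embedding 1 (2 * K) M N \<phi>"
    using \<phi>(1) unfolding coarse_embedding_def by (force simp: abs_le_iff)
  then show thesis by (rule that)
qed

lemma quasi_isometric_imp_coarse_embedding:
  assumes "quasi_isometric M N"
  obtains l C \<phi> where "l \<ge> 1" "coarse_embedding l C M N \<phi>"
proof -
  obtain A B \<phi> where AB: "net M A" "net N B" "bij_betw \<phi> A B" "bi_Lipschitz_on M N A \<phi>"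
    using assms unfolding quasi_isometric_def by blast
  obtain K where K: "K \<ge> 0" "\<And>u. u \<in> mspace M \<Longrightarrow> dist_to M u A \<le> ennreal K" and AM: "A \<subseteq> mspace M"
    using AB(1) unfolding net_def by blast
  have BN: "B \<subseteq> mspace N" using AB(2) unfolding net_def by blast
  obtain l where l: "l \<ge> 1" "\<And>u v. u \<in> A \<Longrightarrow> v \<in> A \<Longrightarrow> mdist M u v / l \<le> mdist N (\<phi> u) (\<phi> v)"
      "\<And>u v. u \<in> A \<Longrightarrow> v \<in> A \<Longrightarrow> mdist N (\<phi> u) (\<phi> v) \<le> l * mdist M u v"
    using AB(4) unfolding bi_Lipschitz_on_def by (auto simp: field_simps)
  have "\<exists>a\<in>A. mdist M u a < K + 1" if "u \<in> mspace M" for u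
  proof -
    have "dist_to M u A < ennreal (K + 1)"
      using K(2)[OF that] K(1) by (elim le_less_trans) (simp add: ennreal_less_iff)
    then show ?thesis by (elim dist_to_lessE) auto
  qed
  then obtain a where a: "\<And>u. u \<in> mspace M \<Longrightarrow> a u \<in> A" "\<And>u. u \<in> mspace M \<Longrightarrow> mdist M u (a u) < K + 1"
    by metis
  \<comment> \<open>Moving two points to the net changes their distance by at most 2 (K + 1); the
    upper bound multiplies this by l.\<close>
  define C where "C = l * (2 * (K + 1))"
  have "coarse_embedding l C M N (\<phi> \<circ> a)"
    unfolding coarse_embedding_def
  proof (intro conjI ballI)
    show "(\<phi> \<circ> a) ` mspace M \<subseteq> mspace N"
      using a(1) AB(3) BN unfolding bij_betw_def by auto
    fix u v assume uv: "u \<in> mspace M" "v \<in> mspace M"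
    have diff: "\<bar>mdist M u v - mdist M (a u) (a v)\<bar> \<le> 2 * (K + 1)"
    proof -
      have "a u \<in> mspace M" "a v \<in> mspace M" using a(1) AM uv by blast+
      then show ?thesis
        using mdist_quadrangle[OF uv, of "a u" "a v"] a(2)[OF uv(1)] a(2)[OF uv(2)] by simp
    qed
    have "mdist M u v / l \<le> mdist M (a u) (a v) / l + 2 * (K + 1) / l"
      using diff l(1) by (simp add: abs_le_iff flip: add_divide_distrib) (auto intro: divide_right_mono)
    moreover have "2 * (K + 1) / l \<le> C"
    proof -
      have "2 * (K + 1) / l \<le> 2 * (K + 1)" using l(1) K(1) by (simp add: divide_le_eq mult_left_le) 
      also have "\<dots> \<le> C" unfolding C_def using l(1) K(1) mult_right_mono[of 1 l "2 * (K + 1)"] by simp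
      finally show ?thesis .
    qed
    ultimately show "mdist M u v / l - C \<le> mdist N ((\<phi> \<circ> a) u) ((\<phi> \<circ> a) v)"
      using l(2)[OF a(1)[OF uv(1)] a(1)[OF uv(2)]] by simp
    have "l * mdist M (a u) (a v) \<le> l * (mdist M u v + 2 * (K + 1))"
      using diff l(1) by (intro mult_left_mono) auto
    then show "mdist N ((\<phi> \<circ> a) u) ((\<phi> \<circ> a) v) \<le> l * mdist M u v + C"
      using l(3)[OF a(1)[OF uv(1)] a(1)[OF uv(2)]] unfolding C_def by (simp add: distrib_left)
  qed
  then show thesis using l(1) that by blast
qed

lemma coarse_embedding_isometric:
  assumes "pointed_isometric M x M' x'" "coarse_embedding l C M' N' \<phi>" "pointed_isometric N' y' N y"
  obtains \<psi> where "coarse_embedding l C M N \<psi>"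
proof -
  obtain f where f: "f ` mspace M = mspace M'"
      "\<And>u v. u \<in> mspace M \<Longrightarrow> v \<in> mspace M \<Longrightarrow> mdist M' (f u) (f v) = mdist M u v"
    using assms(1) unfolding pointed_isometric_def by metis
  obtain g where g: "g ` mspace N' = mspace N"
      "\<And>u v. u \<in> mspace N' \<Longrightarrow> v \<in> mspace N' \<Longrightarrow> mdist N (g u) (g v) = mdist N' u v"
    using assms(3) unfolding pointed_isometric_def by metis
  have fM: "f u \<in> mspace M'" if "u \<in> mspace M" for u using f(1) that by blast
  have \<phi>N: "\<phi> u \<in> mspace N'" if "u \<in> mspace M'" for u using assms(2) that unfolding coarse_embedding_def by blast
  have "coarse_embedding l C M N (g \<circ> \<phi> \<circ> f)"
    unfolding coarse_embedding_def
  proof (intro conjI ballI)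
    show "(g \<circ> \<phi> \<circ> f) ` mspace M \<subseteq> mspace N" using fM \<phi>N g(1) by auto
    fix u v assume uv: "u \<in> mspace M" "v \<in> mspace M"
    have "mdist N ((g \<circ> \<phi> \<circ> f) u) ((g \<circ> \<phi> \<circ> f) v) = mdist N' (\<phi> (f u)) (\<phi> (f v))"
      using g(2) fM \<phi>N uv by simp
    then show "mdist M u v / l - C \<le> mdist N ((g \<circ> \<phi> \<circ> f) u) ((g \<circ> \<phi> \<circ> f) v)"
       "mdist N ((g \<circ> \<phi> \<circ> f) u) ((g \<circ> \<phi> \<circ> f) v) \<le> l * mdist M u v + C"
      using assms(2) fM uv unfolding coarse_embedding_def by (metis f(2))+
  qed
  then show thesis by (rule that)
qed

text \<open>Two parallel copies of the line at height r with the l1 metric; r > 0 separates the two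
  copies of a common point.\<close>

lemma admissible_parallel:
  fixes S S' :: "real set"
  assumes "r > 0"
  obtains d where "admissible (submetric euclidean_metric S) (submetric euclidean_metric S') d"
    "\<And>u v. mdist d (Inl u) (Inl v) = \<bar>u - v\<bar>" "\<And>u v. mdist d (Inr u) (Inr v) = \<bar>u - v\<bar>" 
    "\<And>u v. mdist d (Inl u) (Inr v) = \<bar>u - v\<bar> + r" "\<And>u v. mdist d (Inr u) (Inl v) = \<bar>u - v\<bar> + r"
proof -
  define D where "D s t = (case (s, t) of (Inl u, Inl v) \<Rightarrow> \<bar>u - v\<bar> | (Inr u, Inr v) \<Rightarrow> \<bar>u - v\<bar>
      | (Inl u, Inr v) \<Rightarrow> \<bar>u - v\<bar> + r | (Inr u, Inl v) \<Rightarrow> \<bar>u - v\<bar> + r)" for s t :: "real + real"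
  interpret Metric_space "S <+> S'" D
    by unfold_locales (use assms in \<open>auto simp: D_def split: sum.splits\<close>)
  have "mspace Self = S <+> S'" "mdist Self = D" by (simp_all add: mspace_Self mdist_Self)
  then show thesis
    by (intro that[of Self]) (auto simp: admissible_def D_def dist_real_def)
qed

lemma local_hausdorff_dist_le:
  assumes "\<And>u. u \<in> M \<Longrightarrow> u \<in> mball_of d x R \<Longrightarrow> \<exists>v\<in>N. mdist d u v \<le> e"
    and "\<And>v. v \<in> N \<Longrightarrow> v \<in> mball_of d y R \<Longrightarrow> \<exists>u\<in>M. mdist d v u \<le> e"
  shows "local_hausdorff_dist d R M x N y \<le> ennreal e"
proof -
  have *: "dist_to d u A \<le> ennreal e" if "\<exists>v\<in>A. mdist d u v \<le> e" for u A
    using that unfolding dist_to_def by (meson INF_lower2 ennreal_leI)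
  show ?thesis
    unfolding local_hausdorff_dist_def using assms by (intro max.boundedI SUP_least *) auto
qed

lemma hausdorff_dist_le:
  assumes "\<And>u. u \<in> A \<Longrightarrow> \<exists>v\<in>B. mdist d u v \<le> e" "\<And>v. v \<in> B \<Longrightarrow> \<exists>u\<in>A. mdist d v u \<le> e"
  shows "hausdorff_dist d A B \<le> ennreal e"
proof -
  have *: "dist_to d u A \<le> ennreal e" if "\<exists>v\<in>A. mdist d u v \<le> e" for u A
    using that unfolding dist_to_def by (meson INF_lower2 ennreal_leI)
  show ?thesis
    unfolding hausdorff_dist_def using assms by (intro max.boundedI SUP_least *) auto
qed

lemma net_mspace: "net M (mspace M)"
proof -
  have "dist_to M u (mspace M) \<le> ennreal 0" if "u \<in> mspace M" for u
    unfolding dist_to_def by (rule INF_lower2[OF that]) (simp add: that)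
  then show ?thesis unfolding net_def by (intro conjI exI[of _ 0]) auto
qed

section \<open>Coded sets of points on the line\<close>

text \<open>Consecutive values have ratio (j + 2)^2. One factor pays for the spread of the j-th
  point over [scale j, (j + 1) scale j], the other leaves a gap to the next point whose ratio tends
  to infinity.\<close>

definition scale :: "nat \<Rightarrow> real" where
  "scale j = (fact (Suc j))\<^sup>2"

lemma scale_ge: "real j + 1 \<le> scale j"
proof -
  have "real j + 1 \<le> fact (Suc j)" using fact_ge_self[of "Suc j"] by (metis Suc_eq_plus1 of_nat_1 of_nat_add of_nat_fact of_nat_le_iff)
  moreover have "(fact (Suc j) :: real) \<le> scale j"
    unfolding scale_def by (rule self_le_power) (simp_all del: fact_Suc)
  ultimately show ?thesis by linarith
qed

lemma scale_mono: "j \<le> j' \<Longrightarrow> scale j \<le> scale j'"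
  unfolding scale_def by (intro power_mono fact_mono) auto

lemma scale_gap:
  assumes "j < j'"
  shows "(real j' + 1) * ((real j + 1) * scale j) \<le> scale j'"
proof -
  obtain i where i: "j' = Suc i" "j \<le> i" using assms by (metis Suc_leI Suc_le_D Suc_le_mono)
  have "(real j + 1) * scale j \<le> (real i + 2) * scale i"
    using i(2) scale_mono[OF i(2)] scale_ge[of j] by (intro mult_mono) auto
  then have "(real i + 2) * ((real j + 1) * scale j) \<le> (real i + 2) * ((real i + 2) * scale i)"
    by (intro mult_left_mono) auto
  also have "\<dots> = scale j'"
    by (simp add: i scale_def fact_Suc[of "Suc i"] power2_eq_square add.commute del: fact_Suc)
  finally show ?thesis by (simp add: i add.commute)
qed

locale coded_points =
  fixes P :: "nat \<times> nat \<Rightarrow> bool \<Rightarrow> real"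
  assumes P_lower: "scale (prod_encode i) \<le> P i b"
    and P_upper: "P i b \<le> (real (prod_encode i) + 1) * scale (prod_encode i)"
begin

lemma P_ge: "real (prod_encode i) + 1 \<le> P i b"
  using P_lower scale_ge order_trans by blast

lemma P_pos: "P i b > 0"
  using P_ge[of i b] by linarith

lemma P_gap:
  assumes "prod_encode i < prod_encode i'"
  shows "(real (prod_encode i') + 1) * P i b \<le> P i' b'"
proof -
  have "(real (prod_encode i') + 1) * P i b \<le> (real (prod_encode i') + 1) * ((real (prod_encode i) + 1) * scale (prod_encode i))"
    by (intro mult_left_mono P_upper) auto
  then show ?thesis using scale_gap[OF assms] P_lower[of i' b'] by linarith
qed

lemma P_gap2:
  assumes "prod_encode i < prod_encode i'"
  shows "2 * P i b \<le> P i' b'"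
proof -
  have "2 * P i b \<le> (real (prod_encode i') + 1) * P i b"
    using assms P_pos[of i b] by (intro mult_right_mono) auto
  then show ?thesis using P_gap[OF assms, of b b'] by linarith
qed

text \<open>For distinct indices the positions differ at least by the factor (larger index + 1),
  which exceeds l.\<close>

lemma P_index_eq:
  assumes "P i b \<le> l * P i' b'" "P i' b' \<le> l * P i b" "l \<le> real (prod_encode i)"
  shows "i' = i"
proof (rule ccontr)
  assume "i' \<noteq> i"
  then have "prod_encode i \<noteq> prod_encode i'" by (metis prod_encode_inverse)
  then consider "prod_encode i < prod_encode i'" | "prod_encode i' < prod_encode i" by linarith
  then show False
  proof cases
    case 1
    then have "(real (prod_encode i') + 1) * P i b \<le> l * P i b"
      using P_gap[of i i' b b'] assms(2) by linarith
    then show False using P_pos[of i b] assms(3) 1 by simp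
  next
    case 2
    then have "(real (prod_encode i) + 1) * P i' b' \<le> l * P i' b'"
      using P_gap[of i' i b' b] assms(1) by linarith
    then show False using P_pos[of i' b'] assms(3) by simp
  qed
qed

text \<open>\<open>None\<close> indexes the base point 0, so that all coded spaces are enumerated by
  the same index set.\<close>

definition pt :: "(nat \<times> nat \<Rightarrow> bool) \<Rightarrow> (nat \<times> nat) option \<Rightarrow> real" where
  "pt x o' = (case o' of None \<Rightarrow> 0 | Some i \<Rightarrow> P i (x i))"

lemma pt_simps [simp]: "pt x None = 0" "pt x (Some i) = P i (x i)"
  by (simp_all add: pt_def)

definition pts :: "(nat \<times> nat \<Rightarrow> bool) \<Rightarrow> real set" where
  "pts x = range (pt x)"

definition pt_space :: "(nat \<times> nat \<Rightarrow> bool) \<Rightarrow> real metric" where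
  "pt_space x = submetric euclidean_metric (pts x)"

lemma pts_eq: "pts x = insert 0 (range (\<lambda>i. P i (x i)))"
  by (simp add: pts_def UNIV_option_conv image_image)

lemma pt_space_simps [simp]: "mspace (pt_space x) = pts x" "mdist (pt_space x) = dist"
  by (simp_all add: pt_space_def)

lemma pt_nonneg: "pt x o' \<ge> 0"
  using P_pos by (cases o') (auto intro: less_imp_le)

text \<open>Each point lies at least twice as far out as its predecessor, so distances are those of
  the larger position up to a factor 2. Bi-Lipschitz estimates thereby reduce to ratios of
  positions.\<close>

lemma dist_pt:
  assumes "o1 \<noteq> o2"
  shows "max (pt x o1) (pt x o2) \<le> 2 * dist (pt x o1) (pt x o2)"
    and "dist (pt x o1) (pt x o2) \<le> max (pt x o1) (pt x o2)"
proof -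
  show "max (pt x o1) (pt x o2) \<le> 2 * dist (pt x o1) (pt x o2)"
  proof (cases "o1 = None \<or> o2 = None")
    case True
    then show ?thesis using pt_nonneg[of x o1] pt_nonneg[of x o2] by (auto simp: dist_real_def)
  next
    case False
    then obtain i j where ij: "o1 = Some i" "o2 = Some j" by auto
    then have "prod_encode i \<noteq> prod_encode j" using assms by (metis prod_encode_inverse)
    then consider "prod_encode i < prod_encode j" | "prod_encode j < prod_encode i" by linarith
    then show ?thesis
      using P_gap2[of i j "x i" "x j"] P_gap2[of j i "x j" "x i"] P_pos[of i "x i"] P_pos[of j "x j"]
      by cases (auto simp: ij dist_real_def)
  qed
  show "dist (pt x o1) (pt x o2) \<le> max (pt x o1) (pt x o2)"
    using pt_nonneg[of x o1] pt_nonneg[of x o2] by (auto simp: dist_real_def)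
qed

lemma inj_pt: "inj (pt x)"
proof (rule injI, rule ccontr)
  fix o1 o2 assume "pt x o1 = pt x o2" "o1 \<noteq> o2"
  then have "pt x o1 \<le> 0" "pt x o2 \<le> 0" using dist_pt(1)[of o1 o2 x] by auto
  then have "o1 = None" "o2 = None"
    using P_pos by (metis not_le option.exhaust pt_simps(2))+
  then show False using \<open>o1 \<noteq> o2\<close> by simp
qed

lemma finite_bounded_index: "finite {i. real (prod_encode i) \<le> r}"
proof -
  have "finite (prod_encode -` {..nat \<lceil>r\<rceil>})" by (intro finite_vimageI inj_prod_encode) simp
  then show ?thesis by (rule rev_finite_subset) (auto simp: le_nat_iff, linarith)
qed

lemma pt_space_pointed_proper: "(pt_space x, 0) \<in> pointed_proper"
proof -
  interpret Metric_space "pts x" dist by unfold_locales (auto simp: dist_commute intro: dist_triangle)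
  have top: "mtopology_of (pt_space x) = mtopology" by (simp add: mtopology_of_def)
  have "compactin mtopology (mtopology closure_of mball u r)" for u r
  proof -
    have "mball u r \<subseteq> insert 0 ((\<lambda>i. P i (x i)) ` {i. real (prod_encode i) \<le> \<bar>u\<bar> + r})"
    proof
      fix v assume "v \<in> mball u r"
      then have v: "v \<in> pts x" "\<bar>u - v\<bar> < r" by (auto simp: dist_real_def)
      show "v \<in> insert 0 ((\<lambda>i. P i (x i)) ` {i. real (prod_encode i) \<le> \<bar>u\<bar> + r})"
      proof (cases "v = 0")
        case False
        then obtain i where i: "v = P i (x i)" using v(1) unfolding pts_eq by blast
        then have "real (prod_encode i) \<le> \<bar>u\<bar> + r" using v(2) P_ge[of i "x i"] by linarith
        then show ?thesis using i by blast
      qed simp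
    qed
    then have fin: "finite (mball u r)"
      by (rule finite_subset) (simp add: finite_bounded_index)
    then have "closedin mtopology (mball u r)"
      by (metis Hausdorff_space_mtopology closedin_Hausdorff_finite mball_subset_mspace topspace_mtopology)
    then have "mtopology closure_of mball u r = mball u r" by (simp add: closure_of_closedin)
    then show ?thesis using fin by (simp add: finite_imp_compactin mball_subset_mspace)
  qed
  then have "proper_metric (pt_space x)"
    unfolding proper_metric_def top by (simp add: mball_of_def)
  then show ?thesis by (simp add: pointed_proper_def pts_eq)
qed

section \<open>Codes as points of the Gromov space\<close>

definition code :: "(nat \<times> nat \<Rightarrow> bool) \<Rightarrow> isometry_class" where
  "code x = pointed_isometry_rel `` {(pt_space x, 0)}"

lemma code_in_gromov_space: "code x \<in> gromov_space"
  unfolding code_def gromov_space_def using pt_space_pointed_proper by (rule quotientI)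

lemma in_code: "(pt_space x, 0) \<in> code x"
  using pt_space_pointed_proper by (simp add: code_def pointed_isometry_rel_def pointed_isometric_refl)

lemma bex_code: "Q (pt_space x) 0 \<Longrightarrow> \<exists>(M, m)\<in>code x. Q M m"
  using in_code by blast

lemma code_isometric: "(M, m) \<in> code x \<Longrightarrow> pointed_isometric (pt_space x) 0 M m"
  by (simp add: code_def pointed_isometry_rel_def)

lemma code_isometric': "(M, m) \<in> code x \<Longrightarrow> pointed_isometric M m (pt_space x) 0"
  by (rule pointed_isometric_sym[OF code_isometric]) (auto simp: pts_eq)

text \<open>Points within distance R of the base point have index below R, so there the two sets
  coincide; parallel copies at height r/2 realise the required metric.\<close>

lemma code_entourage:
  assumes r: "r > 0" and agree: "\<And>i. real (prod_encode i) \<le> R \<Longrightarrow> x i = y i"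
  shows "(code x, code y) \<in> gromov_entourage R r"
proof -
  obtain d where d: "admissible (pt_space x) (pt_space y) d"
    "\<And>u v. mdist d (Inl u) (Inl v) = \<bar>u - v\<bar>" "\<And>u v. mdist d (Inr u) (Inr v) = \<bar>u - v\<bar>" 
    "\<And>u v. mdist d (Inl u) (Inr v) = \<bar>u - v\<bar> + r/2" "\<And>u v. mdist d (Inr u) (Inl v) = \<bar>u - v\<bar> + r/2"
    using admissible_parallel[of "r/2" "pts x" "pts y"] r unfolding pt_space_def by auto
  have common: "v \<in> pts z'" if v: "v \<in> pts z" "\<bar>v\<bar> < R" "\<And>i. real (prod_encode i) \<le> R \<Longrightarrow> z i = z' i" for v z z'
  proof (cases "v = 0")
    case False
    then obtain i where i: "v = P i (z i)" using v(1) unfolding pts_eq by blast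
    then have "z i = z' i" using v(2) P_ge[of i "z i"] by (intro v(3)) linarith
    then show ?thesis using i by (auto simp: pts_eq)
  qed (simp add: pts_eq)
  have ball: "mdist d a b < R" if "b \<in> mball_of d a R" for a b
    using that by (simp add: mball_of_def Metric_space.in_mball)
  have "local_hausdorff_dist d R (Inl ` mspace (pt_space x)) (Inl 0) (Inr ` mspace (pt_space y)) (Inr 0) \<le> ennreal (r/2)"
  proof (rule local_hausdorff_dist_le)
    fix u assume u: "u \<in> Inl ` mspace (pt_space x)" "u \<in> mball_of d (Inl 0) R"
    then obtain v where v: "u = Inl v" "v \<in> pts x" by auto
    then have "\<bar>v\<bar> < R" using ball[OF u(2)] d(2)[of 0 v] by simp
    then have "v \<in> pts y" by (rule common[OF v(2) _ agree])
    then show "\<exists>v\<in>Inr ` mspace (pt_space y). mdist d u v \<le> r/2"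
      using v d(4)[of v v] by (intro bexI[of _ "Inr v"]) auto
  next
    fix u assume u: "u \<in> Inr ` mspace (pt_space y)" "u \<in> mball_of d (Inr 0) R"
    then obtain v where v: "u = Inr v" "v \<in> pts y" by auto
    then have "\<bar>v\<bar> < R" using ball[OF u(2)] d(3)[of 0 v] by simp
    then have "v \<in> pts x" by (rule common[OF v(2) _ agree[symmetric]])
    then show "\<exists>v\<in>Inl ` mspace (pt_space x). mdist d u v \<le> r/2"
      using v d(5)[of v v] by (intro bexI[of _ "Inl v"]) auto
  qed
  moreover have "ennreal (mdist d (Inl 0) (Inr 0)) \<le> ennreal (r/2)"
    by (intro ennreal_leI) (simp add: d(4))
  ultimately have "max (ennreal (mdist d (Inl 0) (Inr 0)))
      (local_hausdorff_dist d R (Inl ` mspace (pt_space x)) (Inl 0) (Inr ` mspace (pt_space y)) (Inr 0)) \<le> ennreal (r/2)"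
    by (rule max.boundedI[rotated])
  also have "\<dots> < ennreal r" using r by (simp add: ennreal_less_iff)
  finally have "\<exists>d. admissible (pt_space x) (pt_space y) d \<and> max (ennreal (mdist d (Inl 0) (Inr 0)))
      (local_hausdorff_dist d R (Inl ` mspace (pt_space x)) (Inl 0) (Inr ` mspace (pt_space y)) (Inr 0)) < ennreal r"
    using d(1) by (intro exI[of _ d] conjI)
  then have "\<exists>(M, m)\<in>code x. \<exists>(N, n)\<in>code y. \<exists>d. admissible M N d \<and> max (ennreal (mdist d (Inl m) (Inr n)))
      (local_hausdorff_dist d R (Inl ` mspace M) (Inl m) (Inr ` mspace N) (Inr n)) < ennreal r"
    by (intro bex_code)
  then show ?thesis
    unfolding gromov_entourage_def using code_in_gromov_space by simp
qed

lemma open_code_vimage: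
  assumes "openin gromov_topology U"
  shows "open (code -` U)"
proof (subst open_subopen, intro ballI)
  fix x assume "x \<in> code -` U"
  then obtain R r where Rr: "r > 0" "gromov_entourage R r `` {code x} \<subseteq> U"
    using assms unfolding openin_gromov_topology by blast
  let ?F = "{i. real (prod_encode i) \<le> R}"
  let ?V = "\<Inter>i\<in>?F. (\<lambda>y. y i) -` {x i}"
  have "open ?V"
    by (intro open_INT finite_bounded_index ballI open_vimage continuous_on_product_coordinates) (simp add: open_discrete)
  moreover have "?V \<subseteq> code -` U"
  proof
    fix y assume "y \<in> ?V"
    then have "(code x, code y) \<in> gromov_entourage R r" by (intro code_entourage Rr) auto
    then show "y \<in> code -` U" using Rr(2) by blast
  qed
  ultimately show "\<exists>V. open V \<and> x \<in> V \<and> V \<subseteq> code -` U" by blast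
qed

text \<open>The image of a far point has comparable distance from 0, and only one index allows a
  point at comparable distance.\<close>

lemma coarse_embedding_fixes_far_points:
  assumes \<psi>: "coarse_embedding l C (pt_space x) (pt_space y) \<psi>" and l: "l \<ge> 1"
  obtains N where "\<And>i. N \<le> real (prod_encode i) \<Longrightarrow> \<psi> (P i (x i)) = P i (y i)"
    "\<And>i. N \<le> real (prod_encode i) \<Longrightarrow> P i (x i) \<le> 2 * l * P i (y i) \<and> P i (y i) \<le> 2 * l * P i (x i)"
proof -
  have \<psi>y: "\<psi> u \<in> pts y" if "u \<in> pts x" for u
    using \<psi> that unfolding coarse_embedding_def by auto
  have 0: "0 \<in> pts x" and Px: "P i (x i) \<in> pts x" for i by (auto simp: pts_eq)
  have nn: "u \<ge> 0" if "u \<in> pts z" for u z using that pt_nonneg by (auto simp: pts_def)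
  define K where "K = \<bar>C\<bar> + \<psi> 0"
  have K: "K \<ge> 0" using nn[OF \<psi>y[OF 0]] by (simp add: K_def)
  \<comment> \<open>Beyond 2 l (K + 1) the position swamps the additive error K, so both bounds
    become multiplicative with factor 2 l, and the index is at least 2 l, as
    \<open>P_index_eq\<close> requires.\<close>
  have key: "\<psi> (P i (x i)) = P i (y i) \<and> P i (x i) \<le> 2 * l * P i (y i) \<and> P i (y i) \<le> 2 * l * P i (x i)"
    if i: "2 * l * (K + 1) \<le> real (prod_encode i)" for i
  proof -
    let ?u = "P i (x i)" and ?v = "\<psi> (P i (x i))"
    have u: "?u > 2 * l * (K + 1)" using i P_ge[of i "x i"] by linarith
    have "2 * l * (K + 1) \<ge> 2 * l * 1" "2 * l * (K + 1) \<ge> 1 * (K + 1)"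
      using K l by (intro mult_left_mono mult_right_mono; simp)+
    then have uK: "?u > K + 1" "2 * l \<le> real (prod_encode i)" using u i by auto
    have "\<forall>u\<in>pts x. \<forall>v\<in>pts x. dist u v / l - C \<le> dist (\<psi> u) (\<psi> v) \<and> dist (\<psi> u) (\<psi> v) \<le> l * dist u v + C"
      using \<psi> unfolding coarse_embedding_def by simp
    then have coarse: "dist ?u 0 / l - C \<le> dist ?v (\<psi> 0)" "dist ?v (\<psi> 0) \<le> l * dist ?u 0 + C"
      using 0 Px by blast+
    have "?v \<ge> 0" "\<psi> 0 \<ge> 0" using nn \<psi>y Px 0 by blast+
    then have v1: "?v \<le> l * ?u + K" and v2: "?u / l - K \<le> ?v"
      using coarse P_pos[of i "x i"] by (auto simp: K_def dist_real_def abs_if split: if_splits)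
    have "1 * ?u \<le> l * ?u" using l P_pos[of i "x i"] by (intro mult_right_mono) auto
    then have v3: "?v \<le> 2 * l * ?u" using v1 uK by simp
    have "?u / l > 2 * (K + 1)" using u l by (simp add: less_divide_eq algebra_simps)
    then have "?v > 0" and v4: "?u / l \<le> 2 * ?v" using v2 K by auto
    have v5: "?u \<le> 2 * l * ?v" using v4 l by (simp add: divide_le_eq mult.commute mult.left_commute)
    have "?v \<in> range (\<lambda>j. P j (y j))"
      using \<psi>y[OF Px[of i]] \<open>?v > 0\<close> unfolding pts_eq[of y] insert_iff by linarith
    then obtain j where j: "?v = P j (y j)" by blast
    have "j = i"
      by (rule P_index_eq[of i "x i" "2 * l" j "y j"]) (use v3 v5 uK(2) j in auto)
    then show ?thesis using j v3 v5 by simp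
  qed
  show thesis
    by (rule that[of "2 * l * (K + 1)"]) (simp_all only: key)
qed

section \<open>The two relations between codes in terms of positions\<close>

lemma GH_related_imp_bounded_shift:
  assumes "(code x, code y) \<in> E_GH"
  obtains N K where "\<And>i. N \<le> real (prod_encode i) \<Longrightarrow> \<bar>P i (x i) - P i (y i)\<bar> \<le> K"
proof -
  obtain M m M' m' where M: "(M, m) \<in> code x" "(M', m') \<in> code y" "GH_dist M M' < \<infinity>"
    using assms unfolding E_GH_def by blast
  obtain C \<phi> where "coarse_embedding 1 C M M' \<phi>"
    using GH_dist_finite_imp_coarse_embedding[OF M(3)] .
  then obtain \<psi> where \<psi>: "coarse_embedding 1 C (pt_space x) (pt_space y) \<psi>"
    using coarse_embedding_isometric[OF code_isometric[OF M(1)] _ code_isometric'[OF M(2)]] by metis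
  obtain N where N: "\<And>i. N \<le> real (prod_encode i) \<Longrightarrow> \<psi> (P i (x i)) = P i (y i)"
    using coarse_embedding_fixes_far_points[OF \<psi>] by (metis order_refl)
  have \<psi>': "dist u v - C \<le> dist (\<psi> u) (\<psi> v)" "dist (\<psi> u) (\<psi> v) \<le> dist u v + C" "\<psi> u \<in> pts y"
    if "u \<in> pts x" "v \<in> pts x" for u v
    using \<psi> that unfolding coarse_embedding_def by auto
  have "\<bar>P i (x i) - P i (y i)\<bar> \<le> \<bar>C\<bar> + \<bar>\<psi> 0\<bar>" if i: "N \<le> real (prod_encode i)" for i
  proof -
    have "P i (x i) \<in> pts x" "0 \<in> pts x" by (auto simp: pts_eq)
    then show ?thesis
      using \<psi>'[of "P i (x i)" 0] P_pos[of i "x i"] P_pos[of i "y i"] unfolding N[OF i] dist_real_def by auto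
  qed
  then show thesis by (rule that)
qed

lemma QI_related_imp_bounded_ratio:
  assumes "(code x, code y) \<in> E_QI"
  obtains N K where "\<And>i. N \<le> real (prod_encode i) \<Longrightarrow> P i (x i) \<le> K * P i (y i)"
    "\<And>i. N \<le> real (prod_encode i) \<Longrightarrow> P i (y i) \<le> K * P i (x i)"
proof -
  obtain M m M' m' where M: "(M, m) \<in> code x" "(M', m') \<in> code y" "quasi_isometric M M'"
    using assms unfolding E_QI_def by blast
  obtain l C \<phi> where l: "l \<ge> 1" and "coarse_embedding l C M M' \<phi>"
    using quasi_isometric_imp_coarse_embedding[OF M(3)] .
  then obtain \<psi> where \<psi>: "coarse_embedding l C (pt_space x) (pt_space y) \<psi>"
    using coarse_embedding_isometric[OF code_isometric[OF M(1)] _ code_isometric'[OF M(2)]] by metis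
  obtain N where N: "\<And>i. N \<le> real (prod_encode i) \<Longrightarrow>
      P i (x i) \<le> 2 * l * P i (y i) \<and> P i (y i) \<le> 2 * l * P i (x i)"
    using coarse_embedding_fixes_far_points[OF \<psi> l] by metis
  then show thesis by (intro that[of N "2 * l"]) simp_all
qed

lemma bounded_shift_imp_GH_related:
  assumes K: "\<And>i. \<bar>P i (x i) - P i (y i)\<bar> \<le> K"
  shows "(code x, code y) \<in> E_GH"
proof -
  obtain d where d: "admissible (pt_space x) (pt_space y) d"
    "\<And>u v. mdist d (Inl u) (Inl v) = \<bar>u - v\<bar>" "\<And>u v. mdist d (Inr u) (Inr v) = \<bar>u - v\<bar>"
    "\<And>u v. mdist d (Inl u) (Inr v) = \<bar>u - v\<bar> + 1" "\<And>u v. mdist d (Inr u) (Inl v) = \<bar>u - v\<bar> + 1"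
    using admissible_parallel[of 1 "pts x" "pts y"] unfolding pt_space_def by auto
  \<comment> \<open>Points are matched by index, the base points with each other.\<close>
  have near: "\<exists>v\<in>pts z'. \<bar>u - v\<bar> \<le> \<bar>K\<bar>"
    if u: "u \<in> pts z" and K: "\<And>i. \<bar>P i (z i) - P i (z' i)\<bar> \<le> K" for u z z'
  proof -
    obtain o' where "u = pt z o'" using u unfolding pts_def by blast
    moreover have "\<bar>pt z o' - pt z' o'\<bar> \<le> \<bar>K\<bar>"
      using order_trans[OF K abs_ge_self] by (cases o') auto
    ultimately show ?thesis unfolding pts_def by blast
  qed
  have K': "\<bar>P i (y i) - P i (x i)\<bar> \<le> K" for i using K[of i] by (simp add: abs_minus_commute)
  have "hausdorff_dist d (Inl ` mspace (pt_space x)) (Inr ` mspace (pt_space y)) \<le> ennreal (\<bar>K\<bar> + 1)"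
    by (rule hausdorff_dist_le) (use near[OF _ K] near[OF _ K'] in \<open>force simp: d\<close>)+
  then have "GH_dist (pt_space x) (pt_space y) \<le> ennreal (\<bar>K\<bar> + 1)"
    unfolding GH_dist_def using d(1) by (intro INF_lower2[of d]) auto
  then have "GH_dist (pt_space x) (pt_space y) < \<infinity>"
    by (rule le_less_trans) simp
  then have "\<exists>(M, m)\<in>code x. \<exists>(N, n)\<in>code y. GH_dist M N < \<infinity>"
    by (intro bex_code)
  then show ?thesis unfolding E_GH_def using code_in_gromov_space by simp
qed

lemma bounded_ratio_imp_QI_related:
  assumes K: "\<And>i. P i (x i) \<le> K * P i (y i)" "\<And>i. P i (y i) \<le> K * P i (x i)" and "K \<ge> 1"
  shows "(code x, code y) \<in> E_QI"
proof -
  define \<phi> where "\<phi> = pt y \<circ> inv_into UNIV (pt x)"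
  have \<phi>: "\<phi> (pt x o') = pt y o'" for o' by (simp add: \<phi>_def inj_pt)
  have "bij_betw \<phi> (pts x) (pts y)"
    by (rule bij_betw_imageI) (auto simp: pts_def inj_on_def \<phi> inj_eq[OF inj_pt] image_image)
  moreover have "bi_Lipschitz_on (pt_space x) (pt_space y) (pts x) \<phi>"
    unfolding bi_Lipschitz_on_def
  \<comment> \<open>The factor 2 is the one lost in \<open>dist_pt\<close>; K compares the
    positions.\<close>
  proof (intro exI[of _ "2 * K"] conjI ballI)
    have comp: "dist (pt z' o1) (pt z' o2) \<le> 2 * K * dist (pt z o1) (pt z o2)"
      if z: "\<And>i. P i (z' i) \<le> K * P i (z i)" for z z' o1 o2
    proof (cases "o1 = o2")
      case False
      have "pt z' o' \<le> K * pt z o'" for o' using z by (cases o') auto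
      then have "max (pt z' o1) (pt z' o2) \<le> K * max (pt z o1) (pt z o2)"
        using \<open>K \<ge> 1\<close> by (smt (verit) max_def mult_left_mono)
      also have "\<dots> \<le> K * (2 * dist (pt z o1) (pt z o2))"
        using dist_pt(1)[OF False] \<open>K \<ge> 1\<close> by (intro mult_left_mono) auto
      also have "\<dots> = 2 * K * dist (pt z o1) (pt z o2)" by simp
      finally show ?thesis using dist_pt(2)[OF False, of z'] order_trans by blast
    qed simp
    fix u v assume "u \<in> pts x" "v \<in> pts x"
    then obtain o1 o2 where uv: "u = pt x o1" "v = pt x o2" unfolding pts_def by blast
    show "mdist (pt_space y) (\<phi> u) (\<phi> v) \<le> 2 * K * mdist (pt_space x) u v"
      unfolding uv \<phi> using comp[OF K(2)] by simp
    have "dist u v \<le> 2 * K * dist (\<phi> u) (\<phi> v)"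
      unfolding uv \<phi> by (rule comp[OF K(1)])
    then show "inverse (2 * K) * mdist (pt_space x) u v \<le> mdist (pt_space y) (\<phi> u) (\<phi> v)"
      using \<open>K \<ge> 1\<close> by (simp add: field_simps)
  qed (use \<open>K \<ge> 1\<close> in simp)
  ultimately have "quasi_isometric (pt_space x) (pt_space y)"
    unfolding quasi_isometric_def using net_mspace[of "pt_space x"] net_mspace[of "pt_space y"] by (auto simp del: bi_Lipschitz_on_def)
  then have "\<exists>(M, m)\<in>code x. \<exists>(N, n)\<in>code y. quasi_isometric M N"
    by (intro bex_code)
  then show ?thesis unfolding E_QI_def using code_in_gromov_space by simp
qed

end

section \<open>Non-reducibility\<close>

theorem not_Borel_reducible_orbit_rel:
  fixes G :: "('g, 'm) monoid_scheme"
  assumes G: "Polish_group G T" "Polish_G_space G T X \<phi>"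
    and space: "\<And>x. code x \<in> topspace Y" and cont: "\<And>U. openin Y U \<Longrightarrow> open (code -` U)"
    and column: "\<And>n x a. (code x, code (merge n x a)) \<in> E"
    and all_columns: "\<And>x k. (code x, code (flip (range (\<lambda>n. (n, k n))) x)) \<notin> E"
  shows "\<not> Borel_reducible Y E X (orbit_rel G X \<phi>)"
proof
  assume "Borel_reducible Y E X (orbit_rel G X \<phi>)"
  then obtain \<theta> where \<theta>: "\<theta> \<in> measurable (borel_of Y) (borel_of X)"
    and red: "\<And>x x'. x \<in> topspace Y \<Longrightarrow> x' \<in> topspace Y \<Longrightarrow> (x, x') \<in> E \<longleftrightarrow> (\<theta> x, \<theta> x') \<in> orbit_rel G X \<phi>"
    unfolding Borel_reducible_def by blast
  have Pow: "{U. openin Z U} \<subseteq> Pow (topspace Z)" for Z :: "'z topology"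
    using openin_subset by blast
  have sp: "space (borel_of Z) = topspace Z" and sets: "sets (borel_of Z) = sigma_sets (topspace Z) {U. openin Z U}"
    for Z :: "'z topology"
    by (simp_all add: borel_of_def Pow space_measure_of sets_measure_of)
  \<comment> \<open>Borel sets pull back along the continuous coding to sets with the Baire
    property, by induction on their generation.\<close>
  have BP: "baire_property (code -` S)" if "S \<in> sigma_sets (topspace Y) {U. openin Y U}" for S
    using that
  proof induction
    case (Basic U)
    then show ?case using cont baire_property_open by blast
  next
    case Empty
    then show ?case by (simp add: baire_property_open)
  next
    case (Compl S)
    have "code -` (topspace Y - S) = - (code -` S)" using space by auto
    then show ?case using Compl baire_property_Compl by metis
  next
    case (Union S)
    then show ?case using baire_property_UN[of UNIV "\<lambda>i. code -` S i"] by (simp add: vimage_UN)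
  qed
  interpret orbit_coding G T X \<phi> "\<theta> \<circ> code"
  proof
    show "(\<theta> \<circ> code) z \<in> topspace X" for z
      using measurable_space[OF \<theta>, of "code z"] space by (simp add: sp)
    show "baire_property ((\<theta> \<circ> code) -` U)" if "openin X U" for U
    proof -
      have "U \<in> sets (borel_of X)" using that by (simp add: sets sigma_sets.Basic)
      then have "\<theta> -` U \<inter> topspace Y \<in> sigma_sets (topspace Y) {U. openin Y U}"
        using measurable_sets[OF \<theta>] by (simp add: sp sets)
      then have "baire_property (code -` (\<theta> -` U \<inter> topspace Y))" by (rule BP)
      moreover have "code -` (\<theta> -` U \<inter> topspace Y) = (\<theta> \<circ> code) -` U" using space by auto
      ultimately show ?thesis by simp
    qed
    show "(\<theta> \<circ> code) (merge n x a) \<in> orbit G \<phi> ((\<theta> \<circ> code) x)" for n x a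
      using red[OF space space] column by (simp add: orbit_rel_def)
  qed (use G in auto)
  obtain x k where "(\<theta> \<circ> code) (flip (range (\<lambda>n. (n, k n))) x) \<in> orbit G \<phi> ((\<theta> \<circ> code) x)"
    using infinite_flip_in_orbit by blast
  then have "(\<theta> (code x), \<theta> (code (flip (range (\<lambda>n. (n, k n))) x))) \<in> orbit_rel G X \<phi>"
    using f_space[of x] by (simp add: orbit_rel_def)
  then show False using red[OF space space] all_columns by blast
qed

text \<open>A bit in column n shifts its point by n: bounded within one column, unbounded over all
  columns.\<close>

interpretation GH: coded_points "\<lambda>i b. scale (prod_encode i) + (if b then real (fst i) else 0)"
proof
  fix i :: "nat \<times> nat" and b
  have "real (fst i) \<le> real (prod_encode i) * 1" using le_prod_encode_1[of "fst i" "snd i"] by simp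
  also have "\<dots> \<le> real (prod_encode i) * scale (prod_encode i)"
    using scale_ge[of "prod_encode i"] by (intro mult_left_mono) linarith+
  finally show "scale (prod_encode i) + (if b then real (fst i) else 0)
      \<le> (real (prod_encode i) + 1) * scale (prod_encode i)"
    by (simp add: distrib_right split: if_split)
qed simp

text \<open>The multiplicative analogue, with factor n + 1 in column n.\<close>

interpretation QI: coded_points "\<lambda>i b. (if b then real (fst i) + 1 else 1) * scale (prod_encode i)"
proof
  fix i :: "nat \<times> nat" and b
  have "scale (prod_encode i) > 0" using scale_ge[of "prod_encode i"] by linarith
  moreover have "fst i \<le> prod_encode i" using le_prod_encode_1[of "fst i" "snd i"] by simp
  ultimately show "scale (prod_encode i) \<le> (if b then real (fst i) + 1 else 1) * scale (prod_encode i)"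
    "(if b then real (fst i) + 1 else 1) * scale (prod_encode i) \<le> (real (prod_encode i) + 1) * scale (prod_encode i)"
    by (auto simp: mult_le_cancel_right)
qed

lemma flip_columns: "flip (range (\<lambda>n. (n, k n))) x (n, k n) \<longleftrightarrow> \<not> x (n, k n)"
  by (auto simp: flip_def)

text \<open>Pairing satisfies \<open>prod_encode (n, k) \<ge> n\<close>, so large columns have only
  far points, whatever k is.\<close>

lemma far_column: 
  fixes N K :: real
  obtains n where "K < real n" "N \<le> real (prod_encode (n, k n))"
proof -
  obtain n where n: "max K N < real n" using reals_Archimedean2 by blast
  moreover have "real n \<le> real (prod_encode (n, k n))" using le_prod_encode_1 by simp
  ultimately show thesis by (intro that[of n]) linarith+
qed

lemma GH_column: "(GH.code x, GH.code (merge n x a)) \<in> E_GH"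
  by (rule GH.bounded_shift_imp_GH_related[of _ _ "real n"]) (auto simp: merge_def)

lemma GH_all_columns: "(GH.code x, GH.code (flip (range (\<lambda>n. (n, k n))) x)) \<notin> E_GH"
proof
  assume "(GH.code x, GH.code (flip (range (\<lambda>n. (n, k n))) x)) \<in> E_GH"
  then obtain N K where NK: "\<And>i. N \<le> real (prod_encode i) \<Longrightarrow>
      \<bar>(scale (prod_encode i) + (if x i then real (fst i) else 0)) -
       (scale (prod_encode i) + (if flip (range (\<lambda>n. (n, k n))) x i then real (fst i) else 0))\<bar> \<le> K"
    by (rule GH.GH_related_imp_bounded_shift) (rule that)
  obtain n where n: "K < real n" "N \<le> real (prod_encode (n, k n))" by (rule far_column)
  show False using NK[OF n(2)] n(1) unfolding flip_columns by (auto split: if_splits)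
qed

lemma QI_column: "(QI.code x, QI.code (merge n x a)) \<in> E_QI"
proof (rule QI.bounded_ratio_imp_QI_related[of _ "real n + 1"])
  have "(if b then real n + 1 else 1) * scale m \<le> (real n + 1) * ((if c then real n + 1 else 1) * scale m)" for b c m
  proof -
    have "(if b then real n + 1 else 1) \<le> (real n + 1) * (if c then real n + 1 else 1)"
      by (auto simp: algebra_simps)
    moreover have "scale m \<ge> 0" by (simp add: scale_def)
    ultimately show ?thesis by (metis mult.assoc mult_right_mono)
  qed
  moreover have "s \<le> (real n + 1) * s" if "s \<ge> 0" for s using that by (simp add: algebra_simps)
  moreover have "(if b then real m + 1 else 1) * scale m' \<ge> 0" for b m m' by (simp add: scale_def)
  ultimately show "(if x i then real (fst i) + 1 else 1) * scale (prod_encode i)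
      \<le> (real n + 1) * ((if merge n x a i then real (fst i) + 1 else 1) * scale (prod_encode i))"
    "(if merge n x a i then real (fst i) + 1 else 1) * scale (prod_encode i)
      \<le> (real n + 1) * ((if x i then real (fst i) + 1 else 1) * scale (prod_encode i))" for i
    unfolding merge_def by (cases "fst i = n"; simp only: if_True if_False)+
qed simp

lemma QI_all_columns: "(QI.code x, QI.code (flip (range (\<lambda>n. (n, k n))) x)) \<notin> E_QI"
proof
  assume "(QI.code x, QI.code (flip (range (\<lambda>n. (n, k n))) x)) \<in> E_QI"
  then obtain N K where NK: "\<And>i. N \<le> real (prod_encode i) \<Longrightarrow>
      (if x i then real (fst i) + 1 else 1) * scale (prod_encode i)
      \<le> K * ((if flip (range (\<lambda>n. (n, k n))) x i then real (fst i) + 1 else 1) * scale (prod_encode i))"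
    "\<And>i. N \<le> real (prod_encode i) \<Longrightarrow>
      (if flip (range (\<lambda>n. (n, k n))) x i then real (fst i) + 1 else 1) * scale (prod_encode i)
      \<le> K * ((if x i then real (fst i) + 1 else 1) * scale (prod_encode i))"
    by (rule QI.QI_related_imp_bounded_ratio) (rule that)
  obtain n where n: "K < real n" "N \<le> real (prod_encode (n, k n))" by (rule far_column)
  have pos: "scale (prod_encode (n, k n)) > 0" by (simp add: scale_def)
  \<comment> \<open>Exactly one of the two bits is set; the ratio bound in the corresponding
    direction is the one violated.\<close>
  have "(real n + 1) * scale (prod_encode (n, k n)) \<le> K * scale (prod_encode (n, k n))"
    using NK[OF n(2)] unfolding flip_columns by (cases "x (n, k n)") auto
  then show False using n(1) pos by simp
qed

theorem theorem1p1:
  fixes G :: "('g, 'm) monoid_scheme" and T :: "'g topology"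
    and X :: "'x topology" and \<phi> :: "'g \<Rightarrow> 'x \<Rightarrow> 'x"
  assumes "Polish_group G T" and "Polish_G_space G T X \<phi>"
  shows "\<not> Borel_reducible gromov_topology E_GH X (orbit_rel G X \<phi>) \<and>
         \<not> Borel_reducible gromov_topology E_QI X (orbit_rel G X \<phi>)"
  using not_Borel_reducible_orbit_rel[OF assms, of GH.code gromov_topology E_GH]
    not_Borel_reducible_orbit_rel[OF assms, of QI.code gromov_topology E_QI]
    GH.code_in_gromov_space QI.code_in_gromov_space GH.open_code_vimage QI.open_code_vimage
    GH_column GH_all_columns QI_column QI_all_columns
  by (simp add: topspace_gromov_topology)


end
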